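(* Let $\lambda_\delta(n)$ be the eigenvalues of the nonlocal operator $\mathcal{L}_\delta$ such that $(\lambda_\delta(n))^{-1}$ is strictly decreasing and strictly convex (as a function of $n$). Assume that the following inequalities hold: $$\frac{\partial}{\partial\delta}\Delta_NF(N^*-1;\delta,\omega)\le0,\qquad \frac{\partial}{\partial\delta}\Delta_NF(N^*;\delta,\omega)\le0.$$ Then the nonlocal factor $\delta$ instantly promotes the bubble splitting, namely, $N^*(\gamma,\delta)$ increases with respect to $\delta$. On the contrary, if $$\frac{\partial}{\partial\delta}\Delta_NF(N^*-1;\delta,\omega)\ge0,\qquad \frac{\partial}{\partial\delta}\Delta_NF(N^*;\delta,\omega)\ge0,$$ then the nonlocal factor $\delta$ instantly demotes the bubble splitting, namely, $N^*(\gamma,\delta)$ decreases with respect to $\delta$.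
   Context: Here $\gamma>0$ is the repulsion strength, $\omega\in(0,1/2)$ the relative volume, and $\delta\in(0,\pi]$ the horizon parameter. The operator acts on $2\pi$-periodic functions by $\mathcal{L}_\delta u(x)=\int_{|s|\le\delta}\rho_\delta(s)(u(x)-u(x+s))\,ds$, where $\rho_\delta(s)=\delta^{-3}\rho(|s|/\delta)$ and $\rho\ge0$ is nonincreasing, supported in $[0,1]$, with $\int_0^1\rho(\xi)\xi^2\,d\xi=1$; $\lambda_\delta(n)=2\int_0^\delta\rho_\delta(s)(1-\cos ns)\,ds$ is its eigenvalue on the eigenfunction $e^{inx}$. Set $$F(N;\delta,\omega)=\sum_{m=1}^\infty\frac{1}{\lambda_\delta(mN)}\left(\frac{\sin(m\pi\omega)}{m}\right)^2,\qquad \Delta_NF(N;\delta,\omega)=F(N+1;\delta,\omega)-F(N;\delta,\omega).$$ $N^*=N^*(\gamma,\delta)$ denotes the (largest) minimizer over $N\in\mathbb{Z}^+$ of $2N+\frac{2\gamma}{\pi}F(N;\delta,\omega)$, which is the sharp-interface nonlocal Ohta-Kawasaki energy of the $2\pi$-periodic $\{0,1\}$-valued step function with $N$ equally spaced bubbles (intervals where it equals 1) of equal size and total length $2\pi\omega$. The derivatives in $\delta$ are taken with the integer argument of $\Delta_NF$ held fixed, at the values $N^*-1$ and $N^*$; when $N^*=1$ only the condition at $N^*$ is used. If increasing $\delta$ increases $N^*$ (treating $N^*$ as a continuum, $\partial N^*/\partial\delta\ge0$), $\delta$ is said to promote the bubble splitting; otherwise it demotes it. "Instantly" refers to the effect being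 read off from the derivative in $\delta$, as opposed to "cumulatively", which compares $\delta$ with $\delta=0$. *)

theory Defs
  imports "HOL-Analysis.Analysis"
begin

(* The value at 0 is left unconstrained, so kernels singular at the origin are allowed. *)
definition nonlocal_kernel :: "(real \<Rightarrow> real) \<Rightarrow> bool" where
  "nonlocal_kernel \<rho> \<longleftrightarrow>
     (\<forall>\<xi>>0. 0 \<le> \<rho> \<xi>) \<and> antimono_on {0<..} \<rho> \<and> (\<forall>\<xi>>1. \<rho> \<xi> = 0) \<and>
     ((\<lambda>\<xi>. \<rho> \<xi> * \<xi>\<^sup>2) has_integral 1) {0..1}"

definition scaled_kernel :: "(real \<Rightarrow> real) \<Rightarrow> real \<Rightarrow> real \<Rightarrow> real" where
  "scaled_kernel \<rho> \<delta> s = \<rho> (\<bar>s\<bar> / \<delta>) / \<delta> ^ 3"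

(* The integral is a principal value: only the second moment of the kernel is assumed finite,
   so the integrand need not be absolutely integrable near s = 0. *)
definition nonlocal_op ::
  "(real \<Rightarrow> real) \<Rightarrow> real \<Rightarrow> (real \<Rightarrow> complex) \<Rightarrow> real \<Rightarrow> complex" where
  "nonlocal_op \<rho> \<delta> u x =
     Lim (at_right 0) (\<lambda>\<epsilon>. integral {s. \<epsilon> \<le> \<bar>s\<bar> \<and> \<bar>s\<bar> \<le> \<delta>}
       (\<lambda>s. of_real (scaled_kernel \<rho> \<delta> s) * (u x - u (x + s))))"

definition eigval :: "(real \<Rightarrow> real) \<Rightarrow> real \<Rightarrow> nat \<Rightarrow> real" where
  "eigval \<rho> \<delta> n = 2 * integral {0..\<delta>} (\<lambda>s. scaled_kernel \<rho> \<delta> s * (1 - cos (real n * s)))"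

lemma scaled_kernel_nonneg:
  assumes "nonlocal_kernel \<rho>" "0 < \<delta>" "0 < s"
  shows "0 \<le> scaled_kernel \<rho> \<delta> s"
  using assms by (auto simp: nonlocal_kernel_def scaled_kernel_def)

lemma scaled_kernel_antimono:
  assumes "nonlocal_kernel \<rho>" "0 < \<delta>" "0 < s" "s \<le> t"
  shows "scaled_kernel \<rho> \<delta> t \<le> scaled_kernel \<rho> \<delta> s"
proof -
  have "\<rho> (t / \<delta>) \<le> \<rho> (s / \<delta>)"
    using assms
    by (intro monotone_onD[where f = \<rho> and A = "{0<..}" and orda = "(\<le>)" and ordb = "(\<ge>)"])
       (auto simp: nonlocal_kernel_def divide_right_mono)
  then show ?thesis using assms by (simp add: scaled_kernel_def divide_right_mono)
qed

lemma scaled_kernel_moment: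
  assumes "nonlocal_kernel \<rho>" "0 < \<delta>"
  shows "(\<lambda>s. scaled_kernel \<rho> \<delta> s * s\<^sup>2) integrable_on {0..\<delta>}"
proof -
  have "(\<lambda>\<xi>. \<rho> \<xi> * \<xi>\<^sup>2) integrable_on cbox 0 1"
    using assms by (auto simp: nonlocal_kernel_def)
  then obtain i where "((\<lambda>\<xi>. \<rho> \<xi> * \<xi>\<^sup>2) has_integral i) (cbox 0 1)" by blast
  moreover have "(\<lambda>x. x * \<delta>) ` {0..1} = {0..\<delta>}"
    using assms(2) by (auto simp: image_iff intro!: bexI[of _ "_ / \<delta>"])
  ultimately have "(\<lambda>s. \<rho> (s / \<delta>) * (s / \<delta>)\<^sup>2) integrable_on {0..\<delta>}"
    using assms(2) has_integral_affinity[of "\<lambda>\<xi>. \<rho> \<xi> * \<xi>\<^sup>2" i 0 1 "1 / \<delta>" 0]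
    by (auto simp: integrable_on_def field_simps)
  then have "(\<lambda>s. (\<rho> (s / \<delta>) * (s / \<delta>)\<^sup>2) * (1 / \<delta>)) integrable_on {0..\<delta>}"
    by (rule integrable_on_mult_left)
  then show ?thesis
    using assms by (elim integrable_eq) (auto simp: scaled_kernel_def field_simps power_def eval_nat_numeral)
qed

lemma scaled_kernel_integrable_away:
  fixes g :: "real \<Rightarrow> complex"
  assumes "nonlocal_kernel \<rho>" "0 < \<delta>" "0 < e" "continuous_on {e..\<delta>} g"
  shows "(\<lambda>s. of_real (scaled_kernel \<rho> \<delta> s) * g s) integrable_on {e..\<delta>}"
proof -
  have "mono_on {e..\<delta>} (\<lambda>s. - scaled_kernel \<rho> \<delta> s)"
    using assms by (auto intro!: mono_onI scaled_kernel_antimono)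
  from integrable_mono_on[OF this]
  have "integrable (lebesgue_on {e..\<delta>}) (scaled_kernel \<rho> \<delta>)"
    using Bochner_Integration.integrable_minus[of "lebesgue_on {e..\<delta>}"] by fastforce
  then have "scaled_kernel \<rho> \<delta> absolutely_integrable_on {e..\<delta>}"
    by (simp add: integrable_restrict_space set_integrable_def)
  moreover have "bounded (g ` {e..\<delta>})"
    using assms(4) by (simp add: compact_continuous_image compact_imp_bounded)
  moreover have "g \<in> borel_measurable (lebesgue_on {e..\<delta>})"
    using assms(4) by (simp add: continuous_imp_measurable_on_sets_lebesgue)
  moreover have "bilinear (\<lambda>(z::complex) (r::real). of_real r * z)"
    by (auto simp: bilinear_def linear_iff algebra_simps scaleR_conv_of_real)
  ultimately have "(\<lambda>s. of_real (scaled_kernel \<rho> \<delta> s) * g s) absolutely_integrable_on {e..\<delta>}"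
    by (intro absolutely_integrable_bounded_measurable_product
          [where h = "\<lambda>(z::complex) (r::real). of_real r * z"]) auto
  then show ?thesis by (simp add: absolutely_integrable_on_def)
qed

lemma eigval_integrable:
  assumes "nonlocal_kernel \<rho>" "0 < \<delta>"
  shows "(\<lambda>s. scaled_kernel \<rho> \<delta> s * (1 - cos (real n * s))) integrable_on {0..\<delta>}"
    (is "?f integrable_on _")
proof -
  have "(\<lambda>s. indicator {0<..} s *\<^sub>R ?f s) integrable_on {0..\<delta>}"
  proof (rule measurable_bounded_by_integrable_imp_integrable_real)
    have "mono_on {0<..} (\<lambda>s. - scaled_kernel \<rho> \<delta> s)"
      using assms by (auto intro!: mono_onI scaled_kernel_antimono)
    then have "(\<lambda>s. - scaled_kernel \<rho> \<delta> s) \<in> borel_measurable (restrict_space borel {0<..})"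
      by (intro borel_measurable_mono_on_fnc) auto
    moreover have "(\<lambda>s. 1 - cos (real n * s)) \<in> borel_measurable (restrict_space borel {0<..})"
      by (intro measurable_restrict_space1) auto
    ultimately have "?f \<in> borel_measurable (restrict_space borel {0<..})"
      by (intro borel_measurable_times) simp_all
    then have "(\<lambda>s. indicator {0<..} s *\<^sub>R ?f s) \<in> borel_measurable borel"
      by (subst (asm) borel_measurable_restrict_space_iff) auto
    then show "(\<lambda>s. indicator {0<..} s *\<^sub>R ?f s) \<in> borel_measurable (lebesgue_on {0..\<delta>})"
      by (intro measurable_restrict_space1 measurable_completion) simp
    show "(\<lambda>s. (real n)\<^sup>2 / 2 * (scaled_kernel \<rho> \<delta> s * s\<^sup>2)) integrable_on {0..\<delta>}"
      by (intro integrable_on_mult_right scaled_kernel_moment assms)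
    show "\<bar>indicator {0<..} s *\<^sub>R ?f s\<bar> \<le> (real n)\<^sup>2 / 2 * (scaled_kernel \<rho> \<delta> s * s\<^sup>2)"
      if "s \<in> {0..\<delta>}" for s
    proof (cases "s = 0")
      case False
      then have k: "0 \<le> scaled_kernel \<rho> \<delta> s"
        using that assms by (intro scaled_kernel_nonneg) auto
      have "1 - cos (real n * s) = 2 * (sin (real n * s / 2))\<^sup>2"
        using cos_double_sin[of "real n * s / 2"] by simp
      also have "(sin (real n * s / 2))\<^sup>2 \<le> (real n * s / 2)\<^sup>2"
        using abs_sin_x_le_abs_x[of "real n * s / 2"] by (simp only: abs_le_square_iff)
      also have "2 * (real n * s / 2)\<^sup>2 = (real n)\<^sup>2 / 2 * s\<^sup>2"
        by (simp add: power2_eq_square)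
      finally have "1 - cos (real n * s) \<le> (real n)\<^sup>2 / 2 * s\<^sup>2" by simp
      from mult_left_mono[OF this k]
      have "?f s \<le> (real n)\<^sup>2 / 2 * (scaled_kernel \<rho> \<delta> s * s\<^sup>2)" by (simp add: mult_ac)
      moreover have "0 \<le> ?f s" using k by (intro mult_nonneg_nonneg) auto
      ultimately show ?thesis using False that by simp
    qed auto
  qed simp
  then show ?thesis
  proof (rule integrable_eq)
    show "indicator {0<..} s *\<^sub>R ?f s = ?f s" if "s \<in> {0..\<delta>}" for s
      using that by (cases "s = 0") auto
  qed
qed

(* eigval is indeed the eigenvalue of nonlocal_op. *)
lemma nonlocal_op_eigenfunction:
  assumes "nonlocal_kernel \<rho>" "0 < \<delta>"
  shows "nonlocal_op \<rho> \<delta> (\<lambda>y. exp (\<i> * of_nat n * of_real y)) x =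
           of_real (eigval \<rho> \<delta> n) * exp (\<i> * of_nat n * of_real x)"
proof -
  let ?u = "\<lambda>y::real. exp (\<i> * of_nat n * of_real y) :: complex"
  let ?k = "scaled_kernel \<rho> \<delta>"
  let ?h = "\<lambda>s. of_real (?k s) * (?u x - ?u (x + s))"
  let ?f = "\<lambda>s. ?k s * (1 - cos (real n * s))"
  have u_cis: "?u y = cis (real n * y)" for y
    by (simp add: cis_conv_exp mult_ac)
  have trunc: "integral {s. e \<le> \<bar>s\<bar> \<and> \<bar>s\<bar> \<le> \<delta>} ?h = ?u x * of_real (2 * integral {e..\<delta>} ?f)"
    if e: "0 < e" for e
  proof -
    have "?h integrable_on {e..\<delta>}"
      by (intro scaled_kernel_integrable_away assms e continuous_intros)
    then have 1: "(?h has_integral integral {e..\<delta>} ?h) {e..\<delta>}" by blast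
    have "(\<lambda>s. of_real (?k s) * (?u x - ?u (x - s))) integrable_on {e..\<delta>}"
      by (intro scaled_kernel_integrable_away assms e continuous_intros)
    then have int2: "(\<lambda>s. ?h (- s)) integrable_on {e..\<delta>}"
      by (simp add: scaled_kernel_def)
    then have "((\<lambda>s. ?h (- s)) has_integral integral {e..\<delta>} (\<lambda>s. ?h (- s))) {e..\<delta>}" by blast
    from has_integral_reflect_lemma_real[OF this]
    have 2: "(?h has_integral integral {e..\<delta>} (\<lambda>s. ?h (- s))) {-\<delta>..-e}" by simp
    have "{e..\<delta>} \<inter> {-\<delta>..-e} = {}" using e by auto
    with has_integral_Un[OF 1 2]
    have "(?h has_integral (integral {e..\<delta>} ?h + integral {e..\<delta>} (\<lambda>s. ?h (- s))))
            ({e..\<delta>} \<union> {-\<delta>..-e})" by simp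
    moreover have "{e..\<delta>} \<union> {-\<delta>..-e} = {s. e \<le> \<bar>s\<bar> \<and> \<bar>s\<bar> \<le> \<delta>}" using e by auto
    ultimately have "integral {s. e \<le> \<bar>s\<bar> \<and> \<bar>s\<bar> \<le> \<delta>} ?h =
        integral {e..\<delta>} ?h + integral {e..\<delta>} (\<lambda>s. ?h (- s))"
      by (metis (no_types, lifting) integral_unique)
    also have "\<dots> = integral {e..\<delta>} (\<lambda>s. ?h s + ?h (- s))"
      using 1 int2 by (subst Henstock_Kurzweil_Integration.integral_add) blast+
    also have "(\<lambda>s. ?h s + ?h (- s)) = (\<lambda>s. ?u x * of_real (2 * ?f s))"
    proof
      fix s
      have "(?u x - ?u (x + s)) + (?u x - ?u (x + - s)) = ?u x * of_real (2 * (1 - cos (real n * s)))"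
        unfolding u_cis
        by (simp add: complex_eq_iff algebra_simps cos_add sin_add cos_diff sin_diff)
      moreover have "?k (- s) = ?k s" by (simp add: scaled_kernel_def)
      ultimately show "?h s + ?h (- s) = ?u x * of_real (2 * ?f s)"
        by (metis (no_types, lifting) distrib_left mult.left_commute of_real_mult)
    qed
    also have "integral {e..\<delta>} \<dots> = ?u x * integral {e..\<delta>} (\<lambda>s. of_real (2 * ?f s))"
      by simp
    also have "integral {e..\<delta>} (\<lambda>s. of_real (2 * ?f s) :: complex) = of_real (integral {e..\<delta>} (\<lambda>s. 2 * ?f s))"
    proof -
      have "?f integrable_on {e..\<delta>}"
        using eigval_integrable[OF assms] by (rule integrable_on_subinterval) (use e in auto)
      then have "(\<lambda>s. 2 * ?f s) integrable_on {e..\<delta>}" by (rule integrable_on_mult_right)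
      then show ?thesis
        by (intro integral_unique has_integral_of_real) (rule integrable_integral, assumption)
    qed
    finally show ?thesis by simp
  qed
  have "continuous_on {0..\<delta>} (\<lambda>e. integral {e..\<delta>} ?f)"
    by (intro indefinite_integral_continuous_1' eigval_integrable assms)
  from continuous_on_Icc_at_rightD[OF this assms(2)]
  have "((\<lambda>e. integral {e..\<delta>} ?f) \<longlongrightarrow> integral {0..\<delta>} ?f) (at_right 0)" .
  then have "((\<lambda>e. ?u x * of_real (2 * integral {e..\<delta>} ?f)) \<longlongrightarrow>
      ?u x * of_real (2 * integral {0..\<delta>} ?f)) (at_right 0)"
    by (intro tendsto_intros)
  moreover have "\<forall>\<^sub>F e in at_right 0. ?u x * of_real (2 * integral {e..\<delta>} ?f) =
      integral {s. e \<le> \<bar>s\<bar> \<and> \<bar>s\<bar> \<le> \<delta>} ?h"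
    using eventually_at_right_less by (rule eventually_mono) (rule trunc[symmetric])
  ultimately have "((\<lambda>e. integral {s. e \<le> \<bar>s\<bar> \<and> \<bar>s\<bar> \<le> \<delta>} ?h) \<longlongrightarrow>
      ?u x * of_real (2 * integral {0..\<delta>} ?f)) (at_right 0)"
    by (rule Lim_transform_eventually)
  then have "nonlocal_op \<rho> \<delta> ?u x = ?u x * of_real (2 * integral {0..\<delta>} ?f)"
    unfolding nonlocal_op_def by (rule tendsto_Lim[rotated]) simp
  then show ?thesis
    unfolding eigval_def by (simp only: mult.commute)
qed

definition recip_eigval_decr_convex :: "(real \<Rightarrow> real) \<Rightarrow> real \<Rightarrow> bool" where
  "recip_eigval_decr_convex \<rho> \<delta> \<longleftrightarrow>
     (\<forall>n\<ge>1. 1 / eigval \<rho> \<delta> (n + 1) < 1 / eigval \<rho> \<delta> n) \<and>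
     (\<forall>n\<ge>1. 2 * (1 / eigval \<rho> \<delta> (n + 1)) < 1 / eigval \<rho> \<delta> n + 1 / eigval \<rho> \<delta> (n + 2))"

definition nonlocal_F :: "(real \<Rightarrow> real) \<Rightarrow> real \<Rightarrow> nat \<Rightarrow> real \<Rightarrow> real" where
  "nonlocal_F \<rho> \<omega> N \<delta> =
     (\<Sum>j. let m = Suc j in 1 / eigval \<rho> \<delta> (m * N) * (sin (real m * pi * \<omega>) / real m)\<^sup>2)"

definition \<Delta>F :: "(real \<Rightarrow> real) \<Rightarrow> real \<Rightarrow> nat \<Rightarrow> real \<Rightarrow> real" where
  "\<Delta>F \<rho> \<omega> N \<delta> = nonlocal_F \<rho> \<omega> (N + 1) \<delta> - nonlocal_F \<rho> \<omega> N \<delta>"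

definition bubble_energy :: "(real \<Rightarrow> real) \<Rightarrow> real \<Rightarrow> real \<Rightarrow> real \<Rightarrow> nat \<Rightarrow> real" where
  "bubble_energy \<rho> \<omega> \<gamma> \<delta> N = 2 * real N + 2 * \<gamma> / pi * nonlocal_F \<rho> \<omega> N \<delta>"

definition Nstar :: "(real \<Rightarrow> real) \<Rightarrow> real \<Rightarrow> real \<Rightarrow> real \<Rightarrow> nat" where
  "Nstar \<rho> \<omega> \<gamma> \<delta> =
     (GREATEST N. 1 \<le> N \<and> (\<forall>M\<ge>1. bubble_energy \<rho> \<omega> \<gamma> \<delta> N \<le> bubble_energy \<rho> \<omega> \<gamma> \<delta> M))"

(* The derivative in \<delta> at fixed N exists and is \<le> 0 (resp. \<ge> 0); it is one-sided at \<delta> = pi. *)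
definition \<Delta>F_deriv_nonpos :: "(real \<Rightarrow> real) \<Rightarrow> real \<Rightarrow> nat \<Rightarrow> real \<Rightarrow> bool" where
  "\<Delta>F_deriv_nonpos \<rho> \<omega> N \<delta> \<longleftrightarrow>
     (\<exists>D\<le>0. (\<Delta>F \<rho> \<omega> N has_real_derivative D) (at \<delta> within {0<..pi}))"

definition \<Delta>F_deriv_nonneg :: "(real \<Rightarrow> real) \<Rightarrow> real \<Rightarrow> nat \<Rightarrow> real \<Rightarrow> bool" where
  "\<Delta>F_deriv_nonneg \<rho> \<omega> N \<delta> \<longleftrightarrow>
     (\<exists>D\<ge>0. (\<Delta>F \<rho> \<omega> N has_real_derivative D) (at \<delta> within {0<..pi}))"

(* \<Delta>F at Nstar - 1 = 0 has no meaning and is left out. *)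
definition promotion_condition :: "(real \<Rightarrow> real) \<Rightarrow> real \<Rightarrow> real \<Rightarrow> real \<Rightarrow> bool" where
  "promotion_condition \<rho> \<omega> \<gamma> \<delta> \<longleftrightarrow>
     (let N = Nstar \<rho> \<omega> \<gamma> \<delta>
      in (N \<noteq> 1 \<longrightarrow> \<Delta>F_deriv_nonpos \<rho> \<omega> (N - 1) \<delta>) \<and> \<Delta>F_deriv_nonpos \<rho> \<omega> N \<delta>)"

definition demotion_condition :: "(real \<Rightarrow> real) \<Rightarrow> real \<Rightarrow> real \<Rightarrow> real \<Rightarrow> bool" where
  "demotion_condition \<rho> \<omega> \<gamma> \<delta> \<longleftrightarrow>
     (let N = Nstar \<rho> \<omega> \<gamma> \<delta>
      in (N \<noteq> 1 \<longrightarrow> \<Delta>F_deriv_nonneg \<rho> \<omega> (N - 1) \<delta>) \<and> \<Delta>F_deriv_nonneg \<rho> \<omega> N \<delta>)"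

definition \<Delta>F_lin :: "(real \<Rightarrow> real) \<Rightarrow> real \<Rightarrow> real \<Rightarrow> real \<Rightarrow> real" where
  "\<Delta>F_lin \<rho> \<omega> y \<delta> =
     (1 - frac y) * \<Delta>F \<rho> \<omega> (nat \<lfloor>y\<rfloor>) \<delta> + frac y * \<Delta>F \<rho> \<omega> (nat \<lfloor>y\<rfloor> + 1) \<delta>"

(* The optimal bubble number treated as a continuum. The largest minimizer N satisfies
   2 + 2 \<gamma> / pi * \<Delta>F (N - 1) \<le> 0 < 2 + 2 \<gamma> / pi * \<Delta>F N, and the continuum value is the point of
   [N - 1, N) at which the first-order condition holds with equality, \<Delta>F being interpolated
   linearly between the integers. For N = 1 the left endpoint value \<Delta>F 0 is -\<infinity> (the eigenvalue
   at 0 vanishes); the root of the interpolant tends to 1 as the left value tends to -\<infinity>. *)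
definition Nstar_continuum :: "(real \<Rightarrow> real) \<Rightarrow> real \<Rightarrow> real \<Rightarrow> real \<Rightarrow> real" where
  "Nstar_continuum \<rho> \<omega> \<gamma> \<delta> =
     (let N = Nstar \<rho> \<omega> \<gamma> \<delta>
      in if N = 1 then 1
         else (THE y. real N - 1 \<le> y \<and> y < real N \<and> 2 + 2 * \<gamma> / pi * \<Delta>F_lin \<rho> \<omega> y \<delta> = 0))"

(* One-sided derivatives: the piecewise linear interpolant has kinks, so the left and right
   derivatives of Nstar_continuum may differ where two consecutive integers are both minimizers.
   At \<delta> = pi the right derivative is vacuous. *)
definition instantly_promotes :: "(real \<Rightarrow> real) \<Rightarrow> real \<Rightarrow> real \<Rightarrow> real \<Rightarrow> bool" where
  "instantly_promotes \<rho> \<omega> \<gamma> \<delta> \<longleftrightarrow>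
     (\<exists>D\<ge>0. (Nstar_continuum \<rho> \<omega> \<gamma> has_real_derivative D) (at \<delta> within {0<..\<delta>})) \<and>
     (\<exists>D\<ge>0. (Nstar_continuum \<rho> \<omega> \<gamma> has_real_derivative D) (at \<delta> within {\<delta>..pi}))"

definition instantly_demotes :: "(real \<Rightarrow> real) \<Rightarrow> real \<Rightarrow> real \<Rightarrow> real \<Rightarrow> bool" where
  "instantly_demotes \<rho> \<omega> \<gamma> \<delta> \<longleftrightarrow>
     (\<exists>D\<le>0. (Nstar_continuum \<rho> \<omega> \<gamma> has_real_derivative D) (at \<delta> within {0<..\<delta>})) \<and>
     (\<exists>D\<le>0. (Nstar_continuum \<rho> \<omega> \<gamma> has_real_derivative D) (at \<delta> within {\<delta>..pi}))"

end

theory Submission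
  imports Defs
begin

text \<open>
  The energy of \<open>N\<close> bubbles is a strictly convex sequence in \<open>N\<close> wherever the reciprocal eigenvalues
  are: \<open>F\<close> is a combination of the sequences \<open>N \<mapsto> 1 / \<lambda>\<^sub>\<delta>(m N)\<close> with weights \<open>\<ge> 0\<close>, and the weight of
  \<open>m = 1\<close> is positive. Let \<open>a\<^sub>N(\<delta>) = 2 + (2 \<gamma> / \<pi>) \<Delta>\<^sub>NF(N;\<delta>)\<close> be the cost of the \<open>(N + 1)\<close>-st bubble
  (\<open>marginal\<close>). Convexity makes \<open>a\<^sub>N\<close> strictly increasing in \<open>N\<close>, and the largest minimizer is the
  place where \<open>a\<^sub>N\<close> turns from \<open>\<le> 0\<close> to \<open>> 0\<close>.
  Lowering all the \<open>a\<^sub>N\<close> near the turning point therefore moves it to the right, which is what the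
  promotion condition provides; the demotion condition raises them.

  Two points make this rigorous. First, convexity is known only at \<open>\<delta>\<close> itself, while a derivative
  needs the optimal number at nearby \<open>x\<close>. Each energy is continuous in \<open>\<delta>\<close>
  (\<open>nonlocal_F_continuous_on\<close>: the terms of the series are continuous and dominated by \<open>C / m\<^sup>2\<close>,
  because \<open>\<delta>\<^sup>2 \<lambda>\<^sub>\<delta>(n)\<close> is bounded below uniformly in \<open>n\<close>), and the energy of \<open>N\<close> bubbles is at least \<open>2 N\<close>, so only
  finitely many \<open>N\<close> compete. Hence the minimizer at \<open>x\<close> is one of the at most two minimizers at \<open>\<delta>\<close>
  (\<open>optimal_near_is_minimizer\<close>, \<open>minimizer_cases\<close>).

  Second, the continuum value is explicit: it is \<open>K - a\<^sub>K / (a\<^sub>K\<^sub>+\<^sub>1 - a\<^sub>K)\<close> if the optimal number is \<open>K + 1\<close>.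
  If \<open>a\<^sub>K(\<delta>) < 0\<close>, the quotient rule expresses its derivative as \<open>- (p A + q B)\<close> with \<open>p, q \<ge> 0\<close>, where
  \<open>A\<close> and \<open>B\<close> are the derivatives of \<open>\<Delta>\<^sub>NF\<close> at \<open>K\<close> and \<open>K + 1\<close>. If \<open>a\<^sub>K(\<delta>) = 0\<close>, both \<open>K\<close> and \<open>K + 1\<close> are
  minimizers and the formula changes with the branch, but near \<open>\<delta>\<close> the continuum value is always \<open>K + a\<^sub>K q\<close> with a
  bounded factor \<open>q\<close>. If \<open>A = 0\<close>, the derivative is 0; otherwise \<open>a\<^sub>K\<close> has a constant sign on each side of \<open>\<delta>\<close>,
  only one branch occurs there, and \<open>q\<close> has a limit \<open>\<le> 0\<close>. So one-sided derivatives of the same shape exist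
  (\<open>continuum_derivative\<close>). If a single bubble is optimal, the continuum value is constant near \<open>\<delta>\<close>.

  For the monotonicity on an interval, suppose that \<open>K + 1\<close> is optimal at the left end but \<open>a\<^sub>K > 0\<close> at
  the right end. Just after the last zero of \<open>a\<^sub>K\<close> the optimal number is exactly \<open>K\<close>, so the promotion condition
  says that \<open>a\<^sub>K\<close> does not increase there, a contradiction. The demotion case is the mirror image.
\<close>

section \<open>Dependence of the eigenvalues on the horizon\<close>

lemma nonlocal_kernel_nonneg: "nonlocal_kernel \<rho> \<Longrightarrow> 0 < \<xi> \<Longrightarrow> 0 \<le> \<rho> \<xi>"
  by (simp add: nonlocal_kernel_def)

lemma nonlocal_kernel_antimono: "nonlocal_kernel \<rho> \<Longrightarrow> 0 < \<xi> \<Longrightarrow> \<xi> \<le> \<eta> \<Longrightarrow> \<rho> \<eta> \<le> \<rho> \<xi>"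
  unfolding nonlocal_kernel_def
  by (elim conjE, drule monotone_onD[where x = \<xi> and y = \<eta>]) auto

lemma nonlocal_kernel_moment:
  "nonlocal_kernel \<rho> \<Longrightarrow> ((\<lambda>\<xi>. \<rho> \<xi> * \<xi>\<^sup>2) has_integral 1) {0..1}"
  by (simp add: nonlocal_kernel_def)

text \<open>Rescaling \<open>s = \<delta> \<xi>\<close> moves \<open>\<delta>\<close> out of the kernel and the domain of integration into the smooth factor
  \<open>1 - cos\<close>, where continuity in \<open>\<delta>\<close> and bounds uniform in \<open>n\<close> are accessible.\<close>
lemma eigval_has_integral_unit:
  assumes "nonlocal_kernel \<rho>" "0 < \<delta>"
  shows "((\<lambda>\<xi>. \<rho> \<xi> * (1 - cos (real n * \<delta> * \<xi>))) has_integral \<delta>\<^sup>2 / 2 * eigval \<rho> \<delta> n) {0..1}"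
proof -
  let ?f = "\<lambda>s. scaled_kernel \<rho> \<delta> s * (1 - cos (real n * s))"
  have "(?f has_integral eigval \<rho> \<delta> n / 2) {0..\<delta>}"
    using integrable_integral[OF eigval_integrable[OF assms, of n]] by (simp add: eigval_def)
  then have "((\<lambda>\<xi>. ?f (\<delta> * \<xi>)) has_integral (1 / \<bar>\<delta>\<bar>) *\<^sub>R (eigval \<rho> \<delta> n / 2)) ((\<lambda>\<xi>. \<xi> / \<delta>) ` {0..\<delta>})"
    by (rule has_integral_stretch_real) (use assms in simp)
  moreover have "(\<lambda>\<xi>. \<xi> / \<delta>) ` {0..\<delta>} = {0..1}"
    using assms image_divide_atLeastAtMost[of \<delta> 0 \<delta>] by simp
  ultimately have "((\<lambda>\<xi>. ?f (\<delta> * \<xi>)) has_integral (1 / \<bar>\<delta>\<bar>) *\<^sub>R (eigval \<rho> \<delta> n / 2)) {0..1}"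
    by (simp only:)
  then have "((\<lambda>\<xi>. \<delta> ^ 3 * ?f (\<delta> * \<xi>)) has_integral \<delta> ^ 3 * ((1 / \<bar>\<delta>\<bar>) *\<^sub>R (eigval \<rho> \<delta> n / 2))) {0..1}"
    by (rule has_integral_mult_right)
  moreover have "\<delta> ^ 3 * ((1 / \<bar>\<delta>\<bar>) *\<^sub>R (eigval \<rho> \<delta> n / 2)) = \<delta>\<^sup>2 / 2 * eigval \<rho> \<delta> n"
    using assms by (simp add: power2_eq_square power3_eq_cube)
  ultimately have "((\<lambda>\<xi>. \<delta> ^ 3 * ?f (\<delta> * \<xi>)) has_integral \<delta>\<^sup>2 / 2 * eigval \<rho> \<delta> n) {0..1}"
    by (simp only:)
  moreover have "\<delta> ^ 3 * ?f (\<delta> * \<xi>) = \<rho> \<xi> * (1 - cos (real n * \<delta> * \<xi>))" if "\<xi> \<in> {0..1}" for \<xi>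
    using that assms by (simp add: scaled_kernel_def abs_mult mult.assoc)
  ultimately show ?thesis
    by (rule has_integral_eq[rotated])
qed

text \<open>The kernel may be so singular at 0 that only its second moment is finite, so the increment of \<open>cos\<close>
  has to gain a factor \<open>\<xi>\<^sup>2\<close>. It does: \<open>cos u - cos v\<close> is a product of two sines, each of which
  is linear in \<open>\<xi>\<close>; this makes \<open>\<delta>\<^sup>2 \<lambda>\<^sub>\<delta>(n)\<close> Lipschitz in \<open>\<delta>\<^sup>2\<close>.\<close>
lemma eigval_continuous_on:
  assumes "nonlocal_kernel \<rho>"
  shows "continuous_on {0<..} (\<lambda>\<delta>. eigval \<rho> \<delta> n)"
proof -
  define G where "G \<delta> = \<delta>\<^sup>2 / 2 * eigval \<rho> \<delta> n" for \<delta>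
  have G: "((\<lambda>\<xi>. \<rho> \<xi> * (1 - cos (real n * \<delta> * \<xi>))) has_integral G \<delta>) {0..1}" if "0 < \<delta>" for \<delta>
    unfolding G_def by (rule eigval_has_integral_unit[OF assms that])
  have mom: "((\<lambda>\<xi>. \<rho> \<xi> * \<xi>\<^sup>2) has_integral 1) {0..1}" by (rule nonlocal_kernel_moment[OF assms])
  have lip: "G b - G a \<le> (real n)\<^sup>2 / 2 * \<bar>b\<^sup>2 - a\<^sup>2\<bar>" if "0 < a" "0 < b" for a b
  proof -
    have "G b - G a \<le> ((real n)\<^sup>2 / 2 * \<bar>b\<^sup>2 - a\<^sup>2\<bar>) * 1"
    proof (rule has_integral_le[OF has_integral_diff[OF G G] has_integral_mult_right[OF mom]])
      fix \<xi> :: real assume \<xi>: "\<xi> \<in> {0..1}"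
      show "\<rho> \<xi> * (1 - cos (real n * b * \<xi>)) - \<rho> \<xi> * (1 - cos (real n * a * \<xi>))
              \<le> (real n)\<^sup>2 / 2 * \<bar>b\<^sup>2 - a\<^sup>2\<bar> * (\<rho> \<xi> * \<xi>\<^sup>2)"
      proof (cases "\<xi> = 0")
        case False
        then have pos: "0 \<le> \<rho> \<xi>" using \<xi> by (intro nonlocal_kernel_nonneg[OF assms]) auto
        let ?u = "(real n * a * \<xi> + real n * b * \<xi>) / 2" and ?v = "(real n * b * \<xi> - real n * a * \<xi>) / 2"
        have "cos (real n * a * \<xi>) - cos (real n * b * \<xi>) = 2 * sin ?u * sin ?v"
          by (rule cos_diff_cos)
        also have "\<dots> \<le> 2 * (\<bar>sin ?u\<bar> * \<bar>sin ?v\<bar>)"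
          using abs_ge_self[of "sin ?u * sin ?v"] by (simp only: abs_mult mult.assoc)
        also have "\<dots> \<le> 2 * (\<bar>?u\<bar> * \<bar>?v\<bar>)"
          by (intro mult_left_mono mult_mono abs_sin_x_le_abs_x) auto
        also have "\<dots> = 2 * \<bar>?u * ?v\<bar>" by (simp only: abs_mult)
        also have "?u * ?v = (real n)\<^sup>2 / 4 * \<xi>\<^sup>2 * (b\<^sup>2 - a\<^sup>2)"
          by (simp add: power2_eq_square algebra_simps)
        also have "2 * \<bar>\<dots>\<bar> = (real n)\<^sup>2 / 2 * \<bar>b\<^sup>2 - a\<^sup>2\<bar> * \<xi>\<^sup>2"
          by (simp add: abs_mult)
        finally have "\<rho> \<xi> * (cos (real n * a * \<xi>) - cos (real n * b * \<xi>)) \<le>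
            \<rho> \<xi> * ((real n)\<^sup>2 / 2 * \<bar>b\<^sup>2 - a\<^sup>2\<bar> * \<xi>\<^sup>2)"
          using pos by (rule mult_left_mono)
        then show ?thesis by (simp add: algebra_simps)
      qed auto
    qed (use that in auto)
    then show ?thesis by simp
  qed
  have "continuous_on {0<..} G"
    unfolding continuous_on
  proof
    fix a :: real assume a: "a \<in> {0<..}"
    have "((\<lambda>b. (real n)\<^sup>2 / 2 * \<bar>b\<^sup>2 - a\<^sup>2\<bar>) \<longlongrightarrow> (real n)\<^sup>2 / 2 * \<bar>a\<^sup>2 - a\<^sup>2\<bar>) (at a within {0<..})"
      by (intro tendsto_intros)
    then have lim: "((\<lambda>b. (real n)\<^sup>2 / 2 * \<bar>b\<^sup>2 - a\<^sup>2\<bar>) \<longlongrightarrow> 0) (at a within {0<..})" by simp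
    have "norm (G b - G a) \<le> (real n)\<^sup>2 / 2 * \<bar>b\<^sup>2 - a\<^sup>2\<bar>" if "b \<in> {0<..}" for b
      using lip[of a b] lip[of b a] a that
        abs_minus_commute[of "a\<^sup>2" "b\<^sup>2"]
      unfolding real_norm_def by (intro abs_leI) auto
    then have "\<forall>\<^sub>F b in at a within {0<..}. norm (G b - G a) \<le> (real n)\<^sup>2 / 2 * \<bar>b\<^sup>2 - a\<^sup>2\<bar>"
      by (auto simp: eventually_at_filter)
    then have "((\<lambda>b. G b - G a) \<longlongrightarrow> 0) (at a within {0<..})"
      using lim by (rule Lim_null_comparison)
    then show "(G \<longlongrightarrow> G a) (at a within {0<..})" by (simp add: LIM_zero_iff)
  qed
  then have "continuous_on {0<..} (\<lambda>\<delta>. 2 / \<delta>\<^sup>2 * G \<delta>)"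
    by (intro continuous_intros) auto
  then show ?thesis
    by (rule continuous_on_eq) (simp add: G_def)
qed

lemma nonlocal_kernel_positive_somewhere:
  assumes "nonlocal_kernel \<rho>"
  obtains \<xi> where "0 < \<xi>" "\<xi> \<le> 1" "0 < \<rho> \<xi>"
proof -
  have mom: "((\<lambda>\<xi>. \<rho> \<xi> * \<xi>\<^sup>2) has_integral 1) {0..1}" by (rule nonlocal_kernel_moment[OF assms])
  have "\<exists>\<xi>. 0 < \<xi> \<and> \<xi> \<le> 1 \<and> 0 < \<rho> \<xi>"
  proof (rule ccontr)
    assume no: "\<not> ?thesis"
    have "((\<lambda>\<xi>. \<rho> \<xi> * \<xi>\<^sup>2) has_integral 0) {0..1}"
    proof (rule has_integral_is_0)
      fix \<xi> :: real assume "\<xi> \<in> {0..1}"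
      then show "\<rho> \<xi> * \<xi>\<^sup>2 = 0"
        using no nonlocal_kernel_nonneg[OF assms, of \<xi>] by (cases "\<xi> = 0") (auto intro: antisym)
    qed
    from has_integral_unique[OF this mom] show False by simp
  qed
  then show ?thesis using that by blast
qed

text \<open>Halving the angle: \<open>sin x = 2 sin (x/2) cos (x/2)\<close>, where \<open>\<bar>sin (x/2)\<bar> \<le> x/2\<close> and the cosine is strictly
  below 1 in modulus unless \<open>sin (x/2)\<close> vanishes.\<close>
lemma sin_less_self:
  fixes x :: real
  assumes "0 < x"
  shows "sin x < x"
proof (cases "sin (x / 2) = 0")
  case True
  then show ?thesis using sin_double[of "x / 2"] assms by simp
next
  case False
  have "(cos (x / 2))\<^sup>2 < 1\<^sup>2"
    using False by (simp add: cos_squared_eq)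
  then have "\<bar>cos (x / 2)\<bar> < 1" using power2_less_imp_less[of "\<bar>cos (x / 2)\<bar>" 1] by simp
  then have "\<bar>sin (x / 2)\<bar> * \<bar>cos (x / 2)\<bar> < \<bar>sin (x / 2)\<bar> * 1"
    using False by (intro mult_strict_left_mono) auto
  moreover have "\<bar>sin (x / 2)\<bar> \<le> x / 2" using abs_sin_x_le_abs_x[of "x / 2"] assms by simp
  moreover have "sin x \<le> 2 * (\<bar>sin (x / 2)\<bar> * \<bar>cos (x / 2)\<bar>)"
    using sin_double[of "x / 2"] abs_ge_self[of "sin (x / 2) * cos (x / 2)"] by (simp add: abs_mult)
  ultimately show ?thesis by linarith
qed

text \<open>A compactness argument near the origin; beyond \<open>x = 2\<close> the bound \<open>1 / x \<le> 1 / 2\<close> suffices.\<close>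
lemma sinc_gap:
  fixes x0 :: real
  assumes "0 < x0"
  obtains c where "0 < c" "\<And>x. x0 \<le> x \<Longrightarrow> c \<le> 1 - sin x / x"
proof -
  define m where "m = max x0 2"
  have "\<exists>c\<in>{x0..m}. \<forall>y\<in>{x0..m}. 1 - sin c / c \<le> 1 - sin y / y"
    by (rule continuous_attains_inf) (use assms in \<open>auto simp: m_def intro!: continuous_intros\<close>)
  then obtain c where c: "c \<in> {x0..m}" "\<And>y. y \<in> {x0..m} \<Longrightarrow> 1 - sin c / c \<le> 1 - sin y / y"
    by blast
  have "0 < c" using c assms by auto
  then have "sin c < c" by (rule sin_less_self)
  then have cpos: "0 < 1 - sin c / c" using \<open>0 < c\<close> by simp
  show ?thesis
  proof (rule that[of "min (1 - sin c / c) (1 / 2)"])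
    show "min (1 - sin c / c) (1 / 2) \<le> 1 - sin x / x" if "x0 \<le> x" for x
    proof (cases "x \<le> m")
      case True
      then show ?thesis using c(2)[of x] that by simp
    next
      case False
      then have "2 < x" by (simp add: m_def)
      moreover have "sin x / x \<le> 1 / x" using \<open>2 < x\<close> by (simp add: divide_right_mono)
      moreover have "1 / x \<le> 1 / 2" using \<open>2 < x\<close> by (simp add: field_simps)
      ultimately show ?thesis by linarith
    qed
  qed (use cpos in auto)
qed

lemma eigval_nonneg:
  assumes "nonlocal_kernel \<rho>" "0 < \<delta>"
  shows "0 \<le> eigval \<rho> \<delta> n"
proof -
  have "0 \<le> \<delta>\<^sup>2 / 2 * eigval \<rho> \<delta> n"
  proof (rule has_integral_nonneg[OF eigval_has_integral_unit[OF assms]])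
    show "0 \<le> \<rho> \<xi> * (1 - cos (real n * \<delta> * \<xi>))" if "\<xi> \<in> {0..1}" for \<xi>
      using that nonlocal_kernel_nonneg[OF assms(1), of \<xi>] by (cases "\<xi> = 0") auto
  qed
  then show ?thesis using assms by (simp add: zero_le_mult_iff)
qed

text \<open>A nonincreasing kernel that is positive at \<open>\<xi>0\<close> is at least \<open>\<rho> \<xi>0\<close> on all of \<open>(0, \<xi>0]\<close>, and there the
  integral of \<open>1 - cos k\<xi>\<close> is \<open>\<xi>0 (1 - sinc (k \<xi>0))\<close>, which stays away from 0 for \<open>k \<ge> a\<close>.
  The uniformity in \<open>n\<close> is what makes the series for \<open>F\<close> converge uniformly.\<close>
lemma eigval_lower_bound:
  assumes "nonlocal_kernel \<rho>" "0 < a"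
  obtains c where "0 < c" "\<And>\<delta> n. a \<le> \<delta> \<Longrightarrow> 1 \<le> n \<Longrightarrow> c \<le> \<delta>\<^sup>2 * eigval \<rho> \<delta> n"
proof -
  obtain \<xi>0 where \<xi>0: "0 < \<xi>0" "\<xi>0 \<le> 1" "0 < \<rho> \<xi>0"
    using nonlocal_kernel_positive_somewhere[OF assms(1)] .
  obtain c where c: "0 < c" "\<And>x. a * \<xi>0 \<le> x \<Longrightarrow> c \<le> 1 - sin x / x"
    using sinc_gap[of "a * \<xi>0"] assms \<xi>0 by auto
  show ?thesis
  proof (rule that[of "2 * \<rho> \<xi>0 * \<xi>0 * c"])
    fix \<delta> n assume \<delta>: "a \<le> \<delta>" and n: "1 \<le> (n::nat)"
    define k where "k = real n * \<delta>"
    have "1 * a \<le> k" unfolding k_def using \<delta> n assms by (intro mult_mono) auto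
    then have k: "a \<le> k" "0 < k" using assms by auto
    have "((\<lambda>\<xi>. \<xi> - sin (k * \<xi>) / k) has_vector_derivative (1 - cos (k * \<xi>))) (at \<xi> within {0..\<xi>0})" for \<xi>
      unfolding has_real_derivative_iff_has_vector_derivative[symmetric]
      using k by (auto intro!: derivative_eq_intros)
    then have "((\<lambda>\<xi>. 1 - cos (k * \<xi>)) has_integral (\<xi>0 - sin (k * \<xi>0) / k) - (0 - sin (k * 0) / k)) {0..\<xi>0}"
      using \<xi>0 by (intro fundamental_theorem_of_calculus) auto
    then have I1: "((\<lambda>\<xi>. \<rho> \<xi>0 * (1 - cos (k * \<xi>))) has_integral \<rho> \<xi>0 * (\<xi>0 - sin (k * \<xi>0) / k)) {0..\<xi>0}"
      by (simp add: has_integral_mult_right)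
    have I2: "((\<lambda>\<xi>. \<rho> \<xi> * (1 - cos (k * \<xi>))) has_integral \<delta>\<^sup>2 / 2 * eigval \<rho> \<delta> n) {0..1}"
      unfolding k_def by (rule eigval_has_integral_unit) (use assms \<delta> in auto)
    have nonneg: "0 \<le> \<rho> \<xi> * (1 - cos (k * \<xi>))" if "0 \<le> \<xi>" for \<xi>
      using that nonlocal_kernel_nonneg[OF assms(1), of \<xi>] by (cases "\<xi> = 0") auto
    have sub: "(\<lambda>\<xi>. \<rho> \<xi> * (1 - cos (k * \<xi>))) integrable_on {0..\<xi>0}"
      by (rule integrable_on_subinterval[OF has_integral_integrable[OF I2]]) (use \<xi>0 in auto)
    have "\<rho> \<xi>0 * (\<xi>0 - sin (k * \<xi>0) / k) \<le> integral {0..\<xi>0} (\<lambda>\<xi>. \<rho> \<xi> * (1 - cos (k * \<xi>)))"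
    proof (rule has_integral_le[OF I1])
      show "((\<lambda>\<xi>. \<rho> \<xi> * (1 - cos (k * \<xi>))) has_integral
              integral {0..\<xi>0} (\<lambda>\<xi>. \<rho> \<xi> * (1 - cos (k * \<xi>)))) {0..\<xi>0}"
        by (intro integrable_integral sub)
      fix \<xi> assume \<xi>: "\<xi> \<in> {0..\<xi>0}"
      show "\<rho> \<xi>0 * (1 - cos (k * \<xi>)) \<le> \<rho> \<xi> * (1 - cos (k * \<xi>))"
      proof (cases "\<xi> = 0")
        case False
        then have "\<rho> \<xi>0 \<le> \<rho> \<xi>"
          using \<xi> by (intro nonlocal_kernel_antimono[OF assms(1)]) auto
        then show ?thesis by (rule mult_right_mono) simp
      qed simp
    qed
    also have "\<dots> \<le> integral {0..1} (\<lambda>\<xi>. \<rho> \<xi> * (1 - cos (k * \<xi>)))"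
      using \<xi>0 by (intro integral_subset_le sub has_integral_integrable[OF I2])
         (auto intro: nonneg)
    also have "\<dots> = \<delta>\<^sup>2 / 2 * eigval \<rho> \<delta> n" using I2 by (rule integral_unique)
    finally have le: "\<rho> \<xi>0 * (\<xi>0 - sin (k * \<xi>0) / k) \<le> \<delta>\<^sup>2 / 2 * eigval \<rho> \<delta> n" .
    have "c \<le> 1 - sin (k * \<xi>0) / (k * \<xi>0)"
      using k \<xi>0 by (intro c mult_right_mono) auto
    then have "\<xi>0 * c \<le> \<xi>0 * (1 - sin (k * \<xi>0) / (k * \<xi>0))"
      using \<xi>0 by (intro mult_left_mono) auto
    also have "\<dots> = \<xi>0 - sin (k * \<xi>0) / k" using \<xi>0 k by (simp add: field_simps)
    finally have "\<rho> \<xi>0 * (\<xi>0 * c) \<le> \<rho> \<xi>0 * (\<xi>0 - sin (k * \<xi>0) / k)"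
      using \<xi>0 by (intro mult_left_mono) auto
    then have "\<rho> \<xi>0 * (\<xi>0 * c) \<le> \<delta>\<^sup>2 / 2 * eigval \<rho> \<delta> n" using le by (rule order_trans)
    then show "2 * \<rho> \<xi>0 * \<xi>0 * c \<le> \<delta>\<^sup>2 * eigval \<rho> \<delta> n" by (simp add: mult.assoc)
  qed (use \<xi>0 c in simp)
qed

section \<open>The nonlocal energy term\<close>

definition F_term :: "(real \<Rightarrow> real) \<Rightarrow> real \<Rightarrow> nat \<Rightarrow> real \<Rightarrow> nat \<Rightarrow> real" where
  "F_term \<rho> \<omega> N \<delta> j = 1 / eigval \<rho> \<delta> (Suc j * N) * (sin (real (Suc j) * pi * \<omega>) / real (Suc j))\<^sup>2"

lemma nonlocal_F_eq: "nonlocal_F \<rho> \<omega> N \<delta> = suminf (F_term \<rho> \<omega> N \<delta>)"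
  unfolding nonlocal_F_def F_term_def Let_def ..

lemma F_term_nonneg:
  assumes "nonlocal_kernel \<rho>" "0 < \<delta>"
  shows "0 \<le> F_term \<rho> \<omega> N \<delta> j"
  unfolding F_term_def using eigval_nonneg[OF assms] by (intro mult_nonneg_nonneg) auto

lemma F_term_bound:
  assumes "nonlocal_kernel \<rho>" "0 < a" "1 \<le> N"
  obtains C where "\<And>\<delta> j. \<delta> \<in> {a..pi} \<Longrightarrow> F_term \<rho> \<omega> N \<delta> j \<le> C * (1 / real (Suc j) ^ 2)"
proof -
  obtain c where c: "0 < c" "\<And>\<delta> n. a \<le> \<delta> \<Longrightarrow> 1 \<le> n \<Longrightarrow> c \<le> \<delta>\<^sup>2 * eigval \<rho> \<delta> n"
    using eigval_lower_bound[OF assms(1,2)] by blast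
  show ?thesis
  proof (rule that[of "pi\<^sup>2 / c"])
    fix \<delta> j assume \<delta>: "\<delta> \<in> {a..pi}"
    have "1 \<le> Suc j * N" using assms by (simp add: Suc_le_eq)
    then have c': "c \<le> \<delta>\<^sup>2 * eigval \<rho> \<delta> (Suc j * N)" using \<delta> by (intro c) auto
    have \<delta>2: "0 < \<delta>\<^sup>2" "\<delta>\<^sup>2 \<le> pi\<^sup>2" using \<delta> assms by (auto intro: power_mono)
    have "0 < eigval \<rho> \<delta> (Suc j * N)"
      using c' c(1) \<delta>2(1) by (metis less_le_trans zero_less_mult_pos)
    then have "1 / eigval \<rho> \<delta> (Suc j * N) = \<delta>\<^sup>2 / (\<delta>\<^sup>2 * eigval \<rho> \<delta> (Suc j * N))"
      using \<delta>2 by simp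
    also have "\<dots> \<le> pi\<^sup>2 / c"
      using \<delta>2 c' c by (intro frac_le) auto
    finally have 1: "1 / eigval \<rho> \<delta> (Suc j * N) \<le> pi\<^sup>2 / c" .
    have "(sin (real (Suc j) * pi * \<omega>))\<^sup>2 \<le> 1"
      by (simp add: abs_square_le_1)
    then have 2: "(sin (real (Suc j) * pi * \<omega>) / real (Suc j))\<^sup>2 \<le> 1 / real (Suc j) ^ 2"
      by (simp add: power_divide divide_right_mono)
    show "F_term \<rho> \<omega> N \<delta> j \<le> pi\<^sup>2 / c * (1 / real (Suc j) ^ 2)"
      unfolding F_term_def using 1 2 c by (intro mult_mono) auto
  qed
qed

lemma inverse_Suc_squares_summable: "summable (\<lambda>j. C * (1 / real (Suc j) ^ 2))"
proof -
  have "summable (\<lambda>j. 1 / real j ^ 2)"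
    using inverse_power_summable[of 2, where 'a = real] by (simp add: inverse_eq_divide)
  then have "summable (\<lambda>j. 1 / real (Suc j) ^ 2)" by (subst summable_Suc_iff)
  then show ?thesis by (rule summable_mult)
qed

lemma F_term_summable:
  assumes "nonlocal_kernel \<rho>" "\<delta> \<in> {0<..pi}" "1 \<le> N"
  shows "summable (F_term \<rho> \<omega> N \<delta>)"
proof -
  obtain C where "\<And>d j. d \<in> {\<delta>..pi} \<Longrightarrow> F_term \<rho> \<omega> N d j \<le> C * (1 / real (Suc j) ^ 2)"
    using F_term_bound[OF assms(1) _ assms(3), of \<delta>] assms(2) by auto
  then have "norm (F_term \<rho> \<omega> N \<delta> j) \<le> C * (1 / real (Suc j) ^ 2)" for j
    using F_term_nonneg[OF assms(1), of \<delta>] assms(2) by simp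
  then show ?thesis by (intro summable_comparison_test'[OF inverse_Suc_squares_summable])
qed

lemma nonlocal_F_nonneg:
  assumes "nonlocal_kernel \<rho>" "\<delta> \<in> {0<..pi}" "1 \<le> N"
  shows "0 \<le> nonlocal_F \<rho> \<omega> N \<delta>"
  unfolding nonlocal_F_eq using assms by (intro suminf_nonneg F_term_summable F_term_nonneg) auto

text \<open>The bound on the terms yields uniform convergence on \<open>[a, \<pi>]\<close> for each \<open>a > 0\<close>; continuity being
  local, these intervals cover \<open>(0, \<pi>]\<close>.\<close>
lemma nonlocal_F_continuous_on:
  assumes "nonlocal_kernel \<rho>" "1 \<le> N"
  shows "continuous_on {0<..pi} (nonlocal_F \<rho> \<omega> N)"
proof -
  have cont: "continuous_on {a..pi} (nonlocal_F \<rho> \<omega> N)" if a: "0 < a" for a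
  proof -
    obtain C where C: "\<And>d j. d \<in> {a..pi} \<Longrightarrow> F_term \<rho> \<omega> N d j \<le> C * (1 / real (Suc j) ^ 2)"
      using F_term_bound[OF assms(1) a assms(2)] by blast
    obtain c where c: "0 < c" "\<And>\<delta> n. a \<le> \<delta> \<Longrightarrow> 1 \<le> n \<Longrightarrow> c \<le> \<delta>\<^sup>2 * eigval \<rho> \<delta> n"
      using eigval_lower_bound[OF assms(1) a] by blast
    have "uniform_limit {a..pi} (\<lambda>n \<delta>. \<Sum>j<n. F_term \<rho> \<omega> N \<delta> j) (\<lambda>\<delta>. suminf (F_term \<rho> \<omega> N \<delta>)) sequentially"
      using C F_term_nonneg[OF assms(1)] a
      by (intro Weierstrass_m_test[OF _ inverse_Suc_squares_summable[of C]]) (simp add: abs_of_nonneg)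
    moreover have "continuous_on {a..pi} (\<lambda>\<delta>. \<Sum>j<n. F_term \<rho> \<omega> N \<delta> j)" for n
    proof -
      have "eigval \<rho> \<delta> (Suc j * N) \<noteq> 0" if "\<delta> \<in> {a..pi}" for \<delta> j
        using c(1) c(2)[of \<delta> "Suc j * N"] that assms by (auto simp: Suc_le_eq)
      moreover have "continuous_on {a..pi} (\<lambda>\<delta>. eigval \<rho> \<delta> (Suc j * N))" for j
        by (rule continuous_on_subset[OF eigval_continuous_on[OF assms(1)]]) (use a in auto)
      ultimately show ?thesis
        unfolding F_term_def by (intro continuous_intros) auto
    qed
    ultimately have "continuous_on {a..pi} (\<lambda>\<delta>. suminf (F_term \<rho> \<omega> N \<delta>))"
      by (intro uniform_limit_theorem[of _ "\<lambda>n \<delta>. \<Sum>j<n. F_term \<rho> \<omega> N \<delta> j" sequentially]) auto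
    then show ?thesis unfolding nonlocal_F_eq .
  qed
  show ?thesis
    unfolding continuous_on_eq_continuous_within
  proof
    fix \<delta> :: real assume \<delta>: "\<delta> \<in> {0<..pi}"
    have "continuous (at \<delta> within {\<delta>/2..pi}) (nonlocal_F \<rho> \<omega> N)"
      using cont[of "\<delta>/2"] \<delta> by (auto simp: continuous_on_eq_continuous_within)
    moreover have "at \<delta> within {\<delta>/2..pi} = at \<delta> within {0<..pi}"
      by (rule at_within_nhd[where S = "{\<delta>/2<..}"]) (use \<delta> in auto)
    ultimately show "continuous (at \<delta> within {0<..pi}) (nonlocal_F \<rho> \<omega> N)" by simp
  qed
qed

text \<open>Convexity with step 1 gives convexity with step \<open>m\<close>: the unit increments increase, and each side is a sum
  of \<open>m\<close> of them.\<close>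
lemma convex_step_inequality:
  fixes g :: "nat \<Rightarrow> real"
  assumes conv: "\<And>n. 1 \<le> n \<Longrightarrow> 2 * g (n + 1) < g n + g (n + 2)" and n: "1 \<le> n" and m: "1 \<le> m"
  shows "g (n + m) - g n < g (n + 2 * m) - g (n + m)"
proof -
  define d where "d k = g (Suc k) - g k" for k
  have d_Suc: "d k < d (Suc k)" if "1 \<le> k" for k using conv[OF that] by (simp add: d_def)
  have d_mono: "d k < d l" if "1 \<le> k" "k < l" for k l
    using \<open>k < l\<close>
  proof (induction l)
    case (Suc l)
    then show ?case using d_Suc[of l] that by (cases "k = l") auto
  qed simp
  have tele: "g (k + m) - g k = (\<Sum>i<m. d (k + i))" for k
    unfolding d_def using sum_lessThan_telescope[of "\<lambda>i. g (k + i)" m] by simp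
  have "(\<Sum>i<m. d (n + i)) < (\<Sum>i<m. d ((n + m) + i))"
  proof (rule sum_strict_mono)
    show "{..<m} \<noteq> {}" using \<open>1 \<le> m\<close> by (metis lessThan_iff empty_iff less_eq_Suc_le One_nat_def)
    show "d (n + i) < d (n + m + i)" for i
      using \<open>1 \<le> n\<close> \<open>1 \<le> m\<close> by (intro d_mono) auto
  qed simp
  moreover have "n + m + m = n + 2 * m" by simp
  ultimately show ?thesis using tele[of n] tele[of "n + m"] by metis
qed

text \<open>The weights \<open>(sin (m \<pi> \<omega>) / m)\<^sup>2\<close> are nonnegative and may vanish, but for \<open>m = 1\<close> the weight
  \<open>(sin (\<pi> \<omega>))\<^sup>2\<close> is positive, which keeps the inequality strict.\<close>
lemma nonlocal_F_strictly_convex: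
  assumes "nonlocal_kernel \<rho>" "\<delta> \<in> {0<..pi}" "0 < \<omega>" "\<omega> < 1 / 2"
    "recip_eigval_decr_convex \<rho> \<delta>" "1 \<le> N"
  shows "\<Delta>F \<rho> \<omega> N \<delta> < \<Delta>F \<rho> \<omega> (Suc N) \<delta>"
proof -
  let ?t = "\<lambda>N. F_term \<rho> \<omega> N \<delta>"
  have sm: "summable (?t N)" "summable (?t (N + 1))" "summable (?t (N + 2))"
    using assms by (auto intro!: F_term_summable)
  have g: "1 / eigval \<rho> \<delta> (m * (N + 1)) - 1 / eigval \<rho> \<delta> (m * N)
      < 1 / eigval \<rho> \<delta> (m * (N + 2)) - 1 / eigval \<rho> \<delta> (m * (N + 1))" if "1 \<le> m" for m
  proof -
    have idx: "m * N + m = m * (N + 1)" "m * N + 2 * m = m * (N + 2)" "1 \<le> m * N"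
      using that assms by (auto simp: algebra_simps Suc_le_eq)
    have "2 * (1 / eigval \<rho> \<delta> (n + 1)) < 1 / eigval \<rho> \<delta> n + 1 / eigval \<rho> \<delta> (n + 2)" if "1 \<le> n" for n
      using that assms(5) by (simp add: recip_eigval_decr_convex_def)
    from convex_step_inequality[of "\<lambda>n. 1 / eigval \<rho> \<delta> n", OF this idx(3) that]
    show ?thesis unfolding idx(1,2) .
  qed
  have diff: "(?t (N + 2) j - ?t (N + 1) j) - (?t (N + 1) j - ?t N j) =
      (sin (real (Suc j) * pi * \<omega>) / real (Suc j))\<^sup>2 *
      ((1 / eigval \<rho> \<delta> (Suc j * (N + 2)) - 1 / eigval \<rho> \<delta> (Suc j * (N + 1))) -
       (1 / eigval \<rho> \<delta> (Suc j * (N + 1)) - 1 / eigval \<rho> \<delta> (Suc j * N)))" for j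
    unfolding F_term_def right_diff_distrib by (simp only: mult.commute)
  let ?h = "\<lambda>j. (?t (N + 2) j - ?t (N + 1) j) - (?t (N + 1) j - ?t N j)"
  have "0 < suminf ?h"
  proof (rule suminf_pos2[of _ 0])
    show "summable ?h" by (intro summable_diff sm)
    show "0 \<le> ?h j" for j
      unfolding diff using g[of "Suc j"] by (intro mult_nonneg_nonneg) auto
    have "0 < sin (pi * \<omega>)" using assms by (intro sin_gt_zero) auto
    then show "0 < ?h 0"
      unfolding diff using g[of "Suc 0"] by (intro mult_pos_pos) auto
  qed
  also have "suminf ?h = \<Delta>F \<rho> \<omega> (Suc N) \<delta> - \<Delta>F \<rho> \<omega> N \<delta>"
  proof -
    have "suminf ?h = (suminf (?t (N + 2)) - suminf (?t (N + 1))) - (suminf (?t (N + 1)) - suminf (?t N))"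
      by (simp only: suminf_diff[symmetric] summable_diff sm)
    then show ?thesis by (simp add: \<Delta>F_def nonlocal_F_eq)
  qed
  finally show ?thesis by simp
qed

section \<open>One-sided behaviour of real functions at a zero\<close>

text \<open>As \<open>f\<close> vanishes at \<open>a\<close>, the difference quotient of \<open>f q\<close> is that of \<open>f\<close> times \<open>q\<close>, so a limit of \<open>q\<close> at \<open>a\<close>
  (or a mere bound, if the derivative of \<open>f\<close> is 0) takes the place of differentiability of \<open>q\<close>.\<close>
lemma has_derivative_zero_times_convergent:
  fixes f q :: "real \<Rightarrow> real"
  assumes "(f has_real_derivative D) (at a within S)" "f a = 0" "(q \<longlongrightarrow> L) (at a within S)"
  shows "((\<lambda>x. f x * q x) has_real_derivative D * L) (at a within S)"
proof -
  have "((\<lambda>x. (f x - f a) / (x - a) * q x) \<longlongrightarrow> D * L) (at a within S)"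
    using assms by (intro tendsto_mult) (auto simp: has_field_derivative_iff)
  then show ?thesis
    by (simp add: has_field_derivative_iff \<open>f a = 0\<close>)
qed

lemma has_derivative_zero_times_bounded:
  fixes f q :: "real \<Rightarrow> real"
  assumes "(f has_real_derivative 0) (at a within S)" "f a = 0"
    and "\<forall>\<^sub>F x in at a within S. \<bar>q x\<bar> \<le> C"
  shows "((\<lambda>x. f x * q x) has_real_derivative 0) (at a within S)"
proof -
  have "((\<lambda>x. f x / (x - a)) \<longlongrightarrow> 0) (at a within S)"
    using assms(1,2) by (simp add: has_field_derivative_iff)
  then have "((\<lambda>x. \<bar>f x / (x - a)\<bar> * C) \<longlongrightarrow> 0) (at a within S)"
    by (intro tendsto_mult_left_zero tendsto_rabs_zero)
  moreover have "\<forall>\<^sub>F x in at a within S. norm (f x * q x / (x - a)) \<le> \<bar>f x / (x - a)\<bar> * C"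
    using assms(3)
  proof eventually_elim
    case (elim x)
    then have "\<bar>f x / (x - a)\<bar> * \<bar>q x\<bar> \<le> \<bar>f x / (x - a)\<bar> * C" by (rule mult_left_mono) simp
    then show ?case by (simp add: abs_mult)
  qed
  ultimately have "((\<lambda>x. f x * q x / (x - a)) \<longlongrightarrow> 0) (at a within S)"
    by (rule Lim_null_comparison[rotated])
  then show ?thesis by (simp add: has_field_derivative_iff \<open>f a = 0\<close>)
qed

lemma one_sided_sign_of_nonzero_derivative:
  fixes f :: "real \<Rightarrow> real"
  assumes "(f has_real_derivative D) (at a within S)" "f a = 0" "D \<noteq> 0"
    and side: "S \<subseteq> {..a} \<or> S \<subseteq> {a..}"
  shows "(\<forall>\<^sub>F x in at a within S. f x < 0) \<or> (\<forall>\<^sub>F x in at a within S. 0 < f x)"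
proof -
  have lim: "((\<lambda>x. f x / (x - a)) \<longlongrightarrow> D) (at a within S)"
    using assms(1,2) by (simp add: has_field_derivative_iff)
  have inS: "\<forall>\<^sub>F x in at a within S. x \<in> S \<and> x \<noteq> a"
    by (simp add: eventually_at_filter)
  consider "D < 0" | "0 < D" using \<open>D \<noteq> 0\<close> by linarith
  then show ?thesis
  proof cases
    case 1
    have neg: "\<forall>\<^sub>F x in at a within S. f x / (x - a) < 0" by (rule order_tendstoD(2)[OF lim 1])
    from side show ?thesis
    proof
      assume side: "S \<subseteq> {..a}"
      from neg inS have "\<forall>\<^sub>F x in at a within S. 0 < f x"
        by eventually_elim (use side in \<open>force simp: divide_less_0_iff\<close>)
      then show ?thesis ..
    next
      assume side: "S \<subseteq> {a..}"
      from neg inS have "\<forall>\<^sub>F x in at a within S. f x < 0"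
        by eventually_elim (use side in \<open>force simp: divide_less_0_iff\<close>)
      then show ?thesis ..
    qed
  next
    case 2
    have pos: "\<forall>\<^sub>F x in at a within S. 0 < f x / (x - a)" by (rule order_tendstoD(1)[OF lim 2])
    from side show ?thesis
    proof
      assume side: "S \<subseteq> {..a}"
      from pos inS have "\<forall>\<^sub>F x in at a within S. f x < 0"
        by eventually_elim (use side in \<open>force simp: zero_less_divide_iff\<close>)
      then show ?thesis ..
    next
      assume side: "S \<subseteq> {a..}"
      from pos inS have "\<forall>\<^sub>F x in at a within S. 0 < f x"
        by eventually_elim (use side in \<open>force simp: zero_less_divide_iff\<close>)
      then show ?thesis ..
    qed
  qed
qed

lemma last_zero_before_positive:
  fixes f :: "real \<Rightarrow> real"
  assumes "continuous_on {a..b} f" "a \<le> b" "f a \<le> 0" "0 < f b"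
  obtains \<tau> where "a \<le> \<tau>" "\<tau> < b" "f \<tau> = 0" "\<And>t. \<tau> < t \<Longrightarrow> t \<le> b \<Longrightarrow> 0 < f t"
proof -
  define Z where "Z = {t \<in> {a..b}. f t \<le> 0}"
  have "closed Z"
  proof -
    have "Z = {a..b} \<inter> f -` {..0}" by (auto simp: Z_def)
    then show ?thesis using continuous_closed_preimage[OF assms(1), of "{..0}"] by simp
  qed
  then have "compact Z"
    unfolding compact_eq_bounded_closed
    using bounded_subset[OF bounded_closed_interval[of a b], of Z] by (simp add: Z_def subset_iff)
  moreover have "a \<in> Z" using assms by (simp add: Z_def)
  ultimately obtain \<tau> where \<tau>: "\<tau> \<in> Z" "\<And>t. t \<in> Z \<Longrightarrow> t \<le> \<tau>"
    using compact_attains_sup[of Z] by blast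
  have le: "a \<le> \<tau>" "\<tau> \<le> b" "f \<tau> \<le> 0" using \<tau>(1) by (auto simp: Z_def)
  obtain z where z: "\<tau> \<le> z" "z \<le> b" "f z = 0"
    using IVT'[of f \<tau> 0 b] le assms continuous_on_subset[OF assms(1), of "{\<tau>..b}"] by auto
  then have "z \<le> \<tau>" using le by (intro \<tau>) (auto simp: Z_def)
  then have "f \<tau> = 0" using z by simp
  moreover have "\<tau> < b" using le \<open>f \<tau> = 0\<close> assms(4) by (cases "\<tau> = b") auto
  moreover have "0 < f t" if "\<tau> < t" "t \<le> b" for t
    using \<tau>(2)[of t] that le by (force simp: Z_def)
  ultimately show ?thesis using that le by blast
qed

lemma first_zero_after_positive:
  fixes f :: "real \<Rightarrow> real"
  assumes "continuous_on {a..b} f" "a \<le> b" "0 < f a" "f b \<le> 0"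
  obtains \<tau> where "a < \<tau>" "\<tau> \<le> b" "f \<tau> = 0" "\<And>t. a \<le> t \<Longrightarrow> t < \<tau> \<Longrightarrow> 0 < f t"
proof -
  have "continuous_on {-b..-a} (\<lambda>x. f (- x))"
    by (rule continuous_on_compose2[OF assms(1)]) (auto intro!: continuous_intros)
  then obtain \<sigma> where \<sigma>: "-b \<le> \<sigma>" "\<sigma> < -a" "f (- \<sigma>) = 0"
      "\<And>t. \<sigma> < t \<Longrightarrow> t \<le> -a \<Longrightarrow> 0 < f (- t)"
    using last_zero_before_positive[of "-b" "-a" "\<lambda>x. f (- x)"] assms by auto
  show ?thesis
  proof (rule that[of "- \<sigma>"])
    show "0 < f t" if "a \<le> t" "t < - \<sigma>" for t using \<sigma>(4)[of "- t"] that by simp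
  qed (use \<sigma> in auto)
qed

section \<open>The optimal number of bubbles\<close>

locale bubble_model =
  fixes \<rho> :: "real \<Rightarrow> real" and \<gamma> \<omega> :: real
  assumes kernel: "nonlocal_kernel \<rho>" and \<gamma>_pos: "0 < \<gamma>" and \<omega>_pos: "0 < \<omega>" and \<omega>_less: "\<omega> < 1 / 2"

abbreviation (in bubble_model) energy :: "nat \<Rightarrow> real \<Rightarrow> real" where
  "energy N \<delta> \<equiv> bubble_energy \<rho> \<omega> \<gamma> \<delta> N"

abbreviation (in bubble_model) optimal :: "real \<Rightarrow> nat" where
  "optimal \<equiv> Nstar \<rho> \<omega> \<gamma>"

text \<open>The cost of the \<open>(N + 1)\<close>-st bubble, see \<open>marginal_eq\<close>.\<close>
definition (in bubble_model) marginal :: "nat \<Rightarrow> real \<Rightarrow> real" where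
  "marginal N \<delta> = 2 + 2 * \<gamma> / pi * \<Delta>F \<rho> \<omega> N \<delta>"

definition (in bubble_model) minimizer :: "real \<Rightarrow> nat \<Rightarrow> bool" where
  "minimizer \<delta> N \<longleftrightarrow> 1 \<le> N \<and> (\<forall>M\<ge>1. energy N \<delta> \<le> energy M \<delta>)"

lemma (in bubble_model) marginal_eq: "marginal N \<delta> = energy (Suc N) \<delta> - energy N \<delta>"
  by (simp add: marginal_def bubble_energy_def \<Delta>F_def algebra_simps)

lemma (in bubble_model) energy_ge:
  assumes "\<delta> \<in> {0<..pi}" "1 \<le> N"
  shows "2 * real N \<le> energy N \<delta>"
  using nonlocal_F_nonneg[OF kernel assms] \<gamma>_pos by (simp add: bubble_energy_def)

lemma (in bubble_model) energy_tendsto: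
  assumes "\<delta> \<in> {0<..pi}" "1 \<le> N"
  shows "(energy N \<longlongrightarrow> energy N \<delta>) (at \<delta> within {0<..pi})"
proof -
  have "(nonlocal_F \<rho> \<omega> N \<longlongrightarrow> nonlocal_F \<rho> \<omega> N \<delta>) (at \<delta> within {0<..pi})"
    using nonlocal_F_continuous_on[OF kernel assms(2)] assms(1) by (auto simp: continuous_on)
  then show ?thesis unfolding bubble_energy_def by (intro tendsto_intros)
qed

lemma (in bubble_model) marginal_tendsto:
  assumes "\<delta> \<in> {0<..pi}" "1 \<le> N"
  shows "(marginal N \<longlongrightarrow> marginal N \<delta>) (at \<delta> within {0<..pi})"
proof -
  have "((\<lambda>x. energy (Suc N) x - energy N x) \<longlongrightarrow> energy (Suc N) \<delta> - energy N \<delta>) (at \<delta> within {0<..pi})"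
    using assms by (intro tendsto_diff energy_tendsto) auto
  then show ?thesis by (simp add: marginal_eq[abs_def])
qed

lemma (in bubble_model) marginal_less_Suc:
  assumes "\<delta> \<in> {0<..pi}" "recip_eigval_decr_convex \<rho> \<delta>" "1 \<le> N"
  shows "marginal N \<delta> < marginal (Suc N) \<delta>"
proof -
  have "2 * \<gamma> / pi * \<Delta>F \<rho> \<omega> N \<delta> < 2 * \<gamma> / pi * \<Delta>F \<rho> \<omega> (Suc N) \<delta>"
    using nonlocal_F_strictly_convex[OF kernel assms(1) \<omega>_pos \<omega>_less assms(2,3)] \<gamma>_pos
    by (intro mult_strict_left_mono) auto
  then show ?thesis by (simp add: marginal_def)
qed

lemma (in bubble_model) marginal_strict_mono:
  assumes "\<delta> \<in> {0<..pi}" "recip_eigval_decr_convex \<rho> \<delta>" "1 \<le> M" "M < N"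
  shows "marginal M \<delta> < marginal N \<delta>"
  using \<open>M < N\<close>
proof (induction N)
  case (Suc N)
  show ?case
  proof (cases "M = N")
    case True
    then show ?thesis using marginal_less_Suc[OF assms(1-3)] by simp
  next
    case False
    then have "marginal M \<delta> < marginal N \<delta>" "1 \<le> N" using Suc assms(3) by auto
    then show ?thesis using marginal_less_Suc[OF assms(1,2), of N] by simp
  qed
qed simp

lemma (in bubble_model) minimizer_le:
  assumes "\<delta> \<in> {0<..pi}" "minimizer \<delta> N"
  shows "2 * real N \<le> energy 1 \<delta>"
  using energy_ge[OF assms(1), of N] assms(2) by (auto simp: minimizer_def intro: order_trans)

text \<open>For large \<open>N\<close> the perimeter term \<open>2 N\<close> alone exceeds the energy of a single bubble, so finitely many \<open>N\<close> compete.\<close>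
lemma (in bubble_model) minimizer_exists:
  assumes "\<delta> \<in> {0<..pi}"
  shows "\<exists>N. minimizer \<delta> N"
proof -
  define b where "b = nat \<lceil>energy 1 \<delta>\<rceil> + 1"
  have "\<exists>N\<in>{1..b}. \<forall>M\<in>{1..b}. energy N \<delta> \<le> energy M \<delta>"
  proof -
    have ne: "finite ((\<lambda>N. energy N \<delta>) ` {1..b})" "(\<lambda>N. energy N \<delta>) ` {1..b} \<noteq> {}"
      by (auto simp: b_def)
    obtain N where "N \<in> {1..b}" "Min ((\<lambda>N. energy N \<delta>) ` {1..b}) = energy N \<delta>"
      using Min_in[OF ne] by blast
    then show ?thesis using Min_le[OF ne(1)] by (metis imageI)
  qed
  then obtain N where N: "N \<in> {1..b}" "\<And>M. M \<in> {1..b} \<Longrightarrow> energy N \<delta> \<le> energy M \<delta>" by blast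
  have "energy N \<delta> \<le> energy M \<delta>" if "1 \<le> M" for M
  proof (cases "M \<le> b")
    case True
    then show ?thesis using N that by simp
  next
    case False
    have "energy N \<delta> \<le> energy 1 \<delta>" by (rule N(2)) (simp add: b_def)
    also have "\<dots> \<le> real b" unfolding b_def by linarith
    also have "\<dots> \<le> 2 * real M" using False by simp
    also have "\<dots> \<le> energy M \<delta>" by (rule energy_ge[OF assms that])
    finally show ?thesis .
  qed
  then show ?thesis using N(1) by (auto simp: minimizer_def)
qed

lemma (in bubble_model) Nstar_eq: "optimal \<delta> = (GREATEST N. minimizer \<delta> N)"
  by (simp add: Nstar_def minimizer_def)

lemma (in bubble_model) minimizer_bound:
  assumes "\<delta> \<in> {0<..pi}" "minimizer \<delta> N"
  shows "N \<le> nat \<lceil>energy 1 \<delta>\<rceil>"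
  using minimizer_le[OF assms] by linarith

lemma (in bubble_model) minimizer_optimal:
  assumes "\<delta> \<in> {0<..pi}"
  shows "minimizer \<delta> (optimal \<delta>)"
  unfolding Nstar_eq using minimizer_exists[OF assms] minimizer_bound[OF assms] by (rule GreatestI_ex_nat)

lemma (in bubble_model) minimizer_le_optimal:
  assumes "\<delta> \<in> {0<..pi}" "minimizer \<delta> N"
  shows "N \<le> optimal \<delta>"
  unfolding Nstar_eq using assms(2) minimizer_bound[OF assms(1)] by (rule Greatest_le_nat)

lemma (in bubble_model) optimal_ge_1:
  assumes "\<delta> \<in> {0<..pi}"
  shows "1 \<le> optimal \<delta>"
  using minimizer_optimal[OF assms] by (simp add: minimizer_def)

lemma (in bubble_model) marginal_optimal_pos:
  assumes "\<delta> \<in> {0<..pi}"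
  shows "0 < marginal (optimal \<delta>) \<delta>"
proof (rule ccontr)
  assume "\<not> ?thesis"
  then have "energy (Suc (optimal \<delta>)) \<delta> \<le> energy (optimal \<delta>) \<delta>" by (simp add: marginal_eq)
  then have "minimizer \<delta> (Suc (optimal \<delta>))"
    using minimizer_optimal[OF assms] by (auto simp: minimizer_def intro: order_trans)
  then show False using minimizer_le_optimal[OF assms] by fastforce
qed

lemma (in bubble_model) marginal_pred_optimal_nonpos:
  assumes "\<delta> \<in> {0<..pi}" "optimal \<delta> = Suc K" "1 \<le> K"
  shows "marginal K \<delta> \<le> 0"
  using minimizer_optimal[OF assms(1)] assms(2,3) by (simp add: minimizer_def marginal_eq)

lemma (in bubble_model) less_optimal_if_marginal_nonpos:
  assumes "\<delta> \<in> {0<..pi}" "recip_eigval_decr_convex \<rho> \<delta>" "1 \<le> K" "marginal K \<delta> \<le> 0"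
  shows "K < optimal \<delta>"
proof (rule ccontr)
  assume "\<not> ?thesis"
  then have "optimal \<delta> = K \<or> marginal (optimal \<delta>) \<delta> < marginal K \<delta>"
    using marginal_strict_mono[OF assms(1,2) optimal_ge_1[OF assms(1)], of K] by force
  then show False using marginal_optimal_pos[OF assms(1)] assms(4) by auto
qed

text \<open>The marginal cost is \<open>\<ge> 0\<close> at any minimizer and \<open>\<le> 0\<close> just below the optimal number. As it increases
  strictly in between, a second minimizer can only be one step below.\<close>
lemma (in bubble_model) minimizer_cases:
  assumes \<delta>: "\<delta> \<in> {0<..pi}" and conv: "recip_eigval_decr_convex \<rho> \<delta>" and M: "minimizer \<delta> M"
  shows "M = optimal \<delta> \<or> optimal \<delta> = Suc M \<and> marginal M \<delta> = 0"
proof (cases "M = optimal \<delta>")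
  case False
  then obtain K where K: "optimal \<delta> = Suc K" "M \<le> K"
    using minimizer_le_optimal[OF \<delta> M] by (cases "optimal \<delta>") auto
  have M1: "1 \<le> M" and ge: "0 \<le> marginal M \<delta>" using M by (auto simp: minimizer_def marginal_eq)
  have le: "marginal K \<delta> \<le> 0" using K M1 by (intro marginal_pred_optimal_nonpos[OF \<delta>]) auto
  have "M = K"
  proof (rule ccontr)
    assume "M \<noteq> K"
    then have "marginal M \<delta> < marginal K \<delta>"
      using K M1 by (intro marginal_strict_mono[OF \<delta> conv]) auto
    then show False using ge le by simp
  qed
  then show ?thesis using ge le K by simp
qed simp

lemma (in bubble_model) optimal_of_tie:
  assumes "\<delta> \<in> {0<..pi}" "recip_eigval_decr_convex \<rho> \<delta>" "1 \<le> K" "marginal K \<delta> = 0"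
  shows "optimal \<delta> = Suc K"
proof -
  obtain L where L: "optimal \<delta> = Suc L" "K \<le> L"
    using less_optimal_if_marginal_nonpos[OF assms(1-3)] assms(4) by (cases "optimal \<delta>") auto
  have "marginal L \<delta> \<le> 0" using L assms(3) by (intro marginal_pred_optimal_nonpos[OF assms(1)]) auto
  then have "\<not> K < L" using marginal_strict_mono[OF assms(1-3), of L] assms(4) by auto
  then show ?thesis using L by simp
qed

text \<open>Convexity may fail at the nearby points, so the minimizers there are located by comparison with \<open>\<delta>\<close>. The perimeter bound leaves finitely many candidates, and
  each of them that is not optimal at \<open>\<delta>\<close> loses against \<open>optimal \<delta>\<close> by a margin that survives a
  small change of \<open>\<delta>\<close>.\<close>
lemma (in bubble_model) optimal_near_is_minimizer:
  assumes \<delta>: "\<delta> \<in> {0<..pi}"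
  shows "\<forall>\<^sub>F x in at \<delta> within {0<..pi}. minimizer \<delta> (optimal x)"
proof -
  let ?F = "at \<delta> within {0<..pi}" and ?N = "optimal \<delta>"
  define b where "b = nat \<lceil>energy 1 \<delta> + 1\<rceil>"
  define B where "B = {M \<in> {1..b}. \<not> minimizer \<delta> M}"
  have N: "minimizer \<delta> ?N" by (rule minimizer_optimal[OF \<delta>])
  have "\<forall>M\<in>B. \<forall>\<^sub>F x in ?F. energy ?N x < energy M x"
  proof
    fix M assume M: "M \<in> B"
    have "energy ?N \<delta> < energy M \<delta>"
      using M N by (force simp: B_def minimizer_def not_le)
    then have "0 < energy M \<delta> - energy ?N \<delta>" by simp
    moreover have "((\<lambda>x. energy M x - energy ?N x) \<longlongrightarrow> energy M \<delta> - energy ?N \<delta>) ?F"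
      using M N by (intro tendsto_diff energy_tendsto \<delta>) (auto simp: B_def minimizer_def)
    ultimately have "\<forall>\<^sub>F x in ?F. 0 < energy M x - energy ?N x" by (rule order_tendstoD(1)[rotated])
    then show "\<forall>\<^sub>F x in ?F. energy ?N x < energy M x" by simp
  qed
  then have "\<forall>\<^sub>F x in ?F. \<forall>M\<in>B. energy ?N x < energy M x"
    by (intro eventually_ball_finite) (auto simp: B_def)
  moreover have "\<forall>\<^sub>F x in ?F. energy 1 x < energy 1 \<delta> + 1"
    by (rule order_tendstoD(2)[OF energy_tendsto[OF \<delta>]]) auto
  moreover have "\<forall>\<^sub>F x in ?F. x \<in> {0<..pi}" by (simp add: eventually_at_filter)
  ultimately show ?thesis
  proof eventually_elim
    case (elim x)
    have opt: "minimizer x (optimal x)" by (rule minimizer_optimal[OF elim(3)])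
    have "energy (optimal x) x \<le> energy ?N x" using opt N by (simp add: minimizer_def)
    then have "optimal x \<notin> B" using elim(1) by force
    moreover have "optimal x \<le> b"
      using minimizer_le[OF elim(3) opt] elim(2) unfolding b_def by linarith
    ultimately show ?case using optimal_ge_1[OF elim(3)] by (simp add: B_def)
  qed
qed

section \<open>Instantaneous effect of the horizon\<close>

lemma (in bubble_model) Nstar_continuum_eq_1:
  assumes "optimal \<delta> = 1"
  shows "Nstar_continuum \<rho> \<omega> \<gamma> \<delta> = 1"
  using assms by (simp add: Nstar_continuum_def)

text \<open>On \<open>[K, K + 1)\<close> the first-order condition is affine, with values \<open>\<le> 0\<close> and \<open>> 0\<close> at the two ends, so its root
  is unique and explicit.\<close>
lemma (in bubble_model) Nstar_continuum_eq:
  assumes \<delta>: "\<delta> \<in> {0<..pi}" and K: "optimal \<delta> = Suc K" "1 \<le> K"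
  shows "Nstar_continuum \<rho> \<omega> \<gamma> \<delta> = real K - marginal K \<delta> / (marginal (Suc K) \<delta> - marginal K \<delta>)"
proof -
  let ?a = "marginal K \<delta>" and ?b = "marginal (Suc K) \<delta>"
  have a: "?a \<le> 0" by (rule marginal_pred_optimal_nonpos[OF \<delta> K])
  have b: "0 < ?b" using marginal_optimal_pos[OF \<delta>] K by simp
  have lin: "2 + 2 * \<gamma> / pi * \<Delta>F_lin \<rho> \<omega> y \<delta> = ?a + (y - real K) * (?b - ?a)"
    if "real K \<le> y" "y < real (Suc K)" for y
  proof -
    have fl: "\<lfloor>y\<rfloor> = int K" using that by linarith
    define t where "t = y - real K"
    have "frac y = t" using fl by (simp add: frac_def t_def)
    then have "\<Delta>F_lin \<rho> \<omega> y \<delta> = (1 - t) * \<Delta>F \<rho> \<omega> K \<delta> + t * \<Delta>F \<rho> \<omega> (Suc K) \<delta>"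
      using fl by (simp add: \<Delta>F_lin_def)
    moreover have "2 + k * ((1 - t) * A + t * B) = (2 + k * A) + t * ((2 + k * B) - (2 + k * A))"
      for k A B :: real by (simp add: algebra_simps)
    ultimately show ?thesis
      unfolding t_def[symmetric] marginal_def by (simp only:)
  qed
  let ?y = "real K - ?a / (?b - ?a)"
  have "0 \<le> - ?a / (?b - ?a)" using a b by (intro divide_nonneg_nonneg) auto
  moreover have "- ?a / (?b - ?a) < 1" using a b by (subst pos_divide_less_eq) auto
  ultimately have y: "real K \<le> ?y" "?y < real (Suc K)" by simp_all
  have "(THE y. real (Suc K) - 1 \<le> y \<and> y < real (Suc K) \<and> 2 + 2 * \<gamma> / pi * \<Delta>F_lin \<rho> \<omega> y \<delta> = 0) = ?y"
  proof (rule the_equality)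
    show "real (Suc K) - 1 \<le> ?y \<and> ?y < real (Suc K) \<and> 2 + 2 * \<gamma> / pi * \<Delta>F_lin \<rho> \<omega> ?y \<delta> = 0"
      using y lin[OF y] a b by simp
  next
    fix y assume "real (Suc K) - 1 \<le> y \<and> y < real (Suc K) \<and> 2 + 2 * \<gamma> / pi * \<Delta>F_lin \<rho> \<omega> y \<delta> = 0"
    then have "?a + (y - real K) * (?b - ?a) = 0" using lin[of y] by simp
    then show "y = ?y" using a b by (simp add: field_simps)
  qed
  then show ?thesis using K by (simp add: Nstar_continuum_def)
qed

lemma (in bubble_model) marginal_has_derivative:
  assumes "(\<Delta>F \<rho> \<omega> K has_real_derivative D) (at x within S)"
  shows "(marginal K has_real_derivative 2 * \<gamma> / pi * D) (at x within S)"
  unfolding marginal_def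
  using DERIV_add[OF DERIV_const[of 2] DERIV_cmult[OF assms, of "2 * \<gamma> / pi"]] by simp

text \<open>The two opposite assertions about promotion and demotion both follow from the shape
  \<open>- (p DA + q DB)\<close> with nonnegative coefficients, so the derivative is computed before any sign is assumed.\<close>
lemma (in bubble_model) continuum_derivative:
  assumes \<delta>: "\<delta> \<in> {0<..pi}" and conv: "recip_eigval_decr_convex \<rho> \<delta>"
    and DA: "optimal \<delta> \<noteq> 1 \<Longrightarrow> (\<Delta>F \<rho> \<omega> (optimal \<delta> - 1) has_real_derivative DA) (at \<delta> within {0<..pi})"
    and DB: "(\<Delta>F \<rho> \<omega> (optimal \<delta>) has_real_derivative DB) (at \<delta> within {0<..pi})"
    and S: "S \<subseteq> {0<..pi}" "S \<subseteq> {..\<delta>} \<or> S \<subseteq> {\<delta>..}"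
  shows "\<exists>p q. 0 \<le> p \<and> 0 \<le> q \<and>
    (Nstar_continuum \<rho> \<omega> \<gamma> has_real_derivative - (p * DA + q * DB)) (at \<delta> within S)"
proof -
  let ?y = "Nstar_continuum \<rho> \<omega> \<gamma>" and ?c = "2 * \<gamma> / pi"
  let ?F = "at \<delta> within S"
  have c: "0 < ?c" using \<gamma>_pos by simp
  have le: "?F \<le> at \<delta> within {0<..pi}" using S(1) by (rule at_le)
  have ev_min: "\<forall>\<^sub>F x in ?F. minimizer \<delta> (optimal x)"
    using filter_leD[OF le optimal_near_is_minimizer[OF \<delta>]] .
  have ev_in: "\<forall>\<^sub>F x in ?F. x \<in> {0<..pi}"
    unfolding eventually_at_filter using S(1) by (intro always_eventually) blast
  have mt: "(marginal M \<longlongrightarrow> marginal M \<delta>) ?F" if "1 \<le> M" for M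
    using le marginal_tendsto[OF \<delta> that] by (rule tendsto_mono)
  show ?thesis
  proof (cases "optimal \<delta> = 1")
    case True
    have "\<forall>\<^sub>F x in ?F. ?y x = 1"
      using ev_min
    proof eventually_elim
      case (elim x)
      then have "optimal x = 1"
        using minimizer_le_optimal[OF \<delta> elim] True by (auto simp: minimizer_def)
      then show ?case by (rule Nstar_continuum_eq_1)
    qed
    then have "(?y has_real_derivative 0) ?F"
      by (subst has_field_derivative_cong_eventually[where g = "\<lambda>_. 1"])
        (auto simp: Nstar_continuum_eq_1 True)
    then show ?thesis by (intro exI[of _ 0]) simp
  next
    case False
    then obtain K where K: "optimal \<delta> = Suc K" "1 \<le> K"
      using optimal_ge_1[OF \<delta>] by (cases "optimal \<delta>") auto
    let ?a = "marginal K" and ?b = "marginal (Suc K)"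
    have a\<delta>: "?a \<delta> \<le> 0" by (rule marginal_pred_optimal_nonpos[OF \<delta> K])
    have b\<delta>: "0 < ?b \<delta>" using marginal_optimal_pos[OF \<delta>] K by simp
    have da: "(?a has_real_derivative ?c * DA) ?F"
      using DA[OF False] K S(1) by (intro marginal_has_derivative) (auto intro: has_field_derivative_subset)
    have db: "(?b has_real_derivative ?c * DB) ?F"
      using DB K S(1) by (intro marginal_has_derivative) (auto intro: has_field_derivative_subset)
    have y\<delta>: "?y \<delta> = real K - ?a \<delta> / (?b \<delta> - ?a \<delta>)" by (rule Nstar_continuum_eq[OF \<delta> K])
    show ?thesis
    proof (cases "?a \<delta> = 0")
      case False
      have "\<forall>\<^sub>F x in ?F. ?y x = real K - ?a x / (?b x - ?a x)"
        using ev_min ev_in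
      proof eventually_elim
        case (elim x)
        have "optimal x = Suc K"
          using minimizer_cases[OF \<delta> conv elim(1)] K False by auto
        then show ?case by (rule Nstar_continuum_eq[OF elim(2) _ K(2)])
      qed
      moreover have "((\<lambda>x. real K - ?a x / (?b x - ?a x)) has_real_derivative
          - ((?c * DA * (?b \<delta> - ?a \<delta>) - ?a \<delta> * (?c * DB - ?c * DA)) / ((?b \<delta> - ?a \<delta>) * (?b \<delta> - ?a \<delta>)))) ?F"
        using a\<delta> b\<delta> by (auto intro!: derivative_eq_intros da db)
      ultimately have deriv: "(?y has_real_derivative
          - ((?c * DA * (?b \<delta> - ?a \<delta>) - ?a \<delta> * (?c * DB - ?c * DA)) / ((?b \<delta> - ?a \<delta>) * (?b \<delta> - ?a \<delta>)))) ?F"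
        by (subst has_field_derivative_cong_eventually) (auto simp: y\<delta>)
      have quotient: "(c * DA * (b - a) - a * (c * DB - c * DA)) / W = (c * b / W) * DA + (c * (- a) / W) * DB"
        for a b c W :: real
      proof -
        have "c * DA * (b - a) - a * (c * DB - c * DA) = c * b * DA + c * (- a) * DB"
          by (simp add: algebra_simps)
        then show ?thesis by (simp only: add_divide_distrib times_divide_eq_left)
      qed
      show ?thesis
      proof (intro exI conjI)
        show "(?y has_real_derivative
            - (?c * ?b \<delta> / ((?b \<delta> - ?a \<delta>) * (?b \<delta> - ?a \<delta>)) * DA +
               ?c * (- ?a \<delta>) / ((?b \<delta> - ?a \<delta>) * (?b \<delta> - ?a \<delta>)) * DB)) ?F"
          using deriv unfolding quotient .
        show "0 \<le> ?c * ?b \<delta> / ((?b \<delta> - ?a \<delta>) * (?b \<delta> - ?a \<delta>))"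
          using b\<delta> by (intro divide_nonneg_nonneg mult_nonneg_nonneg[OF less_imp_le[OF c]]) auto
        show "0 \<le> ?c * (- ?a \<delta>) / ((?b \<delta> - ?a \<delta>) * (?b \<delta> - ?a \<delta>))"
          using a\<delta> by (intro divide_nonneg_nonneg mult_nonneg_nonneg[OF less_imp_le[OF c]]) auto
      qed
    next
      case tie: True
      (* At a tie K and K + 1 are both minimizers at \<delta>, so the optimal number may jump between them near \<delta>.
         The continuum value is K + (marginal K) q throughout: q is qr where the optimal number is K + 1, and
         ql where it is K. For K = 1 the lower branch is constant, hence ql = 0. *)
      define qr where "qr x = - (1 / (?b x - ?a x))" for x
      define ql where "ql x = (if K = 1 then 0 else - (1 / (?a x - marginal (K - 1) x)))" for x
      define q where "q x = (if optimal x = Suc K then qr x else ql x)" for x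
      have y_eq: "?y x = real K + ?a x * q x"
        if x: "x \<in> {0<..pi}" and m: "minimizer \<delta> (optimal x)" for x
      proof (cases "optimal x = Suc K")
        case True
        then show ?thesis using Nstar_continuum_eq[OF x True K(2)] by (simp add: q_def qr_def)
      next
        case False
        then have opt: "optimal x = K" using minimizer_cases[OF \<delta> conv m] K by auto
        show ?thesis
        proof (cases "K = 1")
          case True
          then show ?thesis using opt Nstar_continuum_eq_1[of x] by (simp add: q_def ql_def)
        next
          case False
          then have K': "optimal x = Suc (K - 1)" "1 \<le> K - 1" "Suc (K - 1) = K" using K opt by auto
          have "marginal (K - 1) x \<le> 0" by (rule marginal_pred_optimal_nonpos[OF x K'(1,2)])
          moreover have "0 < ?a x" using marginal_optimal_pos[OF x] opt by simp
          ultimately have "?a x - marginal (K - 1) x \<noteq> 0" by simp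
          moreover have "?y x = real (K - 1) - marginal (K - 1) x / (?a x - marginal (K - 1) x)"
            using Nstar_continuum_eq[OF x K'(1,2)] K'(3) by simp
          ultimately show ?thesis
            using False K(2) opt by (simp add: q_def ql_def of_nat_diff field_simps)
        qed
      qed
      have ev_y: "\<forall>\<^sub>F x in ?F. ?y x = real K + ?a x * q x"
        using ev_min ev_in by eventually_elim (rule y_eq)
      have y_iff: "(?y has_real_derivative D) ?F" if "((\<lambda>x. ?a x * q x) has_real_derivative D) ?F" for D
      proof -
        have "((\<lambda>x. real K + ?a x * q x) has_real_derivative D) ?F"
          using DERIV_add[OF DERIV_const that] by simp
        then show ?thesis
          by (subst has_field_derivative_cong_eventually[OF ev_y])
            (auto simp: y_eq[OF \<delta> minimizer_optimal[OF \<delta>]])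
      qed
      have qr: "(qr \<longlongrightarrow> qr \<delta>) ?F"
        unfolding qr_def using tie b\<delta> K by (intro tendsto_intros mt) auto
      have prev: "marginal (K - 1) \<delta> < 0" if "K \<noteq> 1"
        using marginal_strict_mono[OF \<delta> conv, of "K - 1" K] that K(2) tie by auto
      have ql: "(ql \<longlongrightarrow> ql \<delta>) ?F"
      proof (cases "K = 1")
        case False
        have "((\<lambda>x. - (1 / (?a x - marginal (K - 1) x))) \<longlongrightarrow> - (1 / (?a \<delta> - marginal (K - 1) \<delta>))) ?F"
          using prev[OF False] tie K(2) False by (intro tendsto_intros mt) auto
        then show ?thesis using False by (simp add: ql_def[abs_def])
      qed (simp add: ql_def[abs_def])
      have qr_nonpos: "qr \<delta> \<le> 0" using tie b\<delta> by (simp add: qr_def)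
      have ql_nonpos: "ql \<delta> \<le> 0" using tie prev by (auto simp: ql_def divide_le_0_iff)
      show ?thesis
      (* If DA = 0, the sign of marginal K near \<delta> is unknown and q may oscillate, but a bounded q suffices.
         If DA is nonzero, marginal K has a constant sign on each side of \<delta>, so only one branch occurs there. *)
      proof (cases "DA = 0")
        case True
        have "\<forall>\<^sub>F x in ?F. \<bar>qr x\<bar> < \<bar>qr \<delta>\<bar> + 1" "\<forall>\<^sub>F x in ?F. \<bar>ql x\<bar> < \<bar>ql \<delta>\<bar> + 1"
          by (rule order_tendstoD(2)[OF tendsto_rabs[OF qr]] order_tendstoD(2)[OF tendsto_rabs[OF ql]]; simp)+
        then have "\<forall>\<^sub>F x in ?F. \<bar>q x\<bar> \<le> max (\<bar>qr \<delta>\<bar> + 1) (\<bar>ql \<delta>\<bar> + 1)"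
          by eventually_elim (auto simp: q_def)
        then have "((\<lambda>x. ?a x * q x) has_real_derivative 0) ?F"
          using da True tie by (intro has_derivative_zero_times_bounded) auto
        from y_iff[OF this] show ?thesis by (intro exI[of _ 0]) simp
      next
        case False
        have "\<exists>L\<le>0. (q \<longlongrightarrow> L) ?F"
        proof -
          consider "\<forall>\<^sub>F x in ?F. ?a x < 0" | "\<forall>\<^sub>F x in ?F. 0 < ?a x"
            using one_sided_sign_of_nonzero_derivative[OF da tie _ S(2)] False \<gamma>_pos by auto
          then show ?thesis
          proof cases
            case 1
            have "\<forall>\<^sub>F x in ?F. qr x = q x"
              using 1 ev_min ev_in
            proof eventually_elim
              case (elim x)
              then have "optimal x \<noteq> K" using marginal_optimal_pos[OF elim(3)] by auto
              then have "optimal x = Suc K" using minimizer_cases[OF \<delta> conv elim(2)] K by auto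
              then show ?case by (simp add: q_def)
            qed
            with qr have "(q \<longlongrightarrow> qr \<delta>) ?F" by (rule Lim_transform_eventually)
            then show ?thesis using qr_nonpos by blast
          next
            case 2
            have "\<forall>\<^sub>F x in ?F. ql x = q x"
              using 2 ev_in
            proof eventually_elim
              case (elim x)
              then have "optimal x \<noteq> Suc K" using marginal_pred_optimal_nonpos[OF elim(2) _ K(2)] by force
              then show ?case by (simp add: q_def)
            qed
            with ql have "(q \<longlongrightarrow> ql \<delta>) ?F" by (rule Lim_transform_eventually)
            then show ?thesis using ql_nonpos by blast
          qed
        qed
        then obtain L where L: "L \<le> 0" "(q \<longlongrightarrow> L) ?F" by blast
        have "(?y has_real_derivative ?c * DA * L) ?F"
          by (rule y_iff[OF has_derivative_zero_times_convergent[OF da tie L(2)]])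
        moreover have "?c * DA * L = - ((?c * (- L)) * DA + 0 * DB)" by simp
        moreover have "0 \<le> ?c * (- L)" using c L(1) by (intro mult_nonneg_nonneg) auto
        ultimately show ?thesis by (metis order_refl)
      qed
    qed
  qed
qed

lemma (in bubble_model) promotes:
  assumes \<delta>: "\<delta> \<in> {0<..pi}" and "recip_eigval_decr_convex \<rho> \<delta>" "promotion_condition \<rho> \<omega> \<gamma> \<delta>"
  shows "instantly_promotes \<rho> \<omega> \<gamma> \<delta>"
proof -
  obtain DA where DA: "DA \<le> 0" "optimal \<delta> \<noteq> 1 \<Longrightarrow> (\<Delta>F \<rho> \<omega> (optimal \<delta> - 1) has_real_derivative DA) (at \<delta> within {0<..pi})"
    using assms(3) by (auto simp: promotion_condition_def \<Delta>F_deriv_nonpos_def Let_def)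
  obtain DB where DB: "DB \<le> 0" "(\<Delta>F \<rho> \<omega> (optimal \<delta>) has_real_derivative DB) (at \<delta> within {0<..pi})"
    using assms(3) by (auto simp: promotion_condition_def \<Delta>F_deriv_nonpos_def Let_def)
  have side: "\<exists>D\<ge>0. (Nstar_continuum \<rho> \<omega> \<gamma> has_real_derivative D) (at \<delta> within S)"
    if S: "S \<subseteq> {0<..pi}" "S \<subseteq> {..\<delta>} \<or> S \<subseteq> {\<delta>..}" for S
  proof -
    obtain p q where "0 \<le> p" "0 \<le> q"
      "(Nstar_continuum \<rho> \<omega> \<gamma> has_real_derivative - (p * DA + q * DB)) (at \<delta> within S)"
      using continuum_derivative[OF assms(1,2) DA(2) DB(2) S] by blast
    moreover have "p * DA + q * DB \<le> 0"
      using \<open>0 \<le> p\<close> \<open>0 \<le> q\<close> DA DB by (intro add_nonpos_nonpos mult_nonneg_nonpos)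
    ultimately show ?thesis by (metis neg_0_le_iff_le)
  qed
  show ?thesis
    unfolding instantly_promotes_def by (intro conjI side) (use \<delta> in auto)
qed

lemma (in bubble_model) demotes:
  assumes \<delta>: "\<delta> \<in> {0<..pi}" and "recip_eigval_decr_convex \<rho> \<delta>" "demotion_condition \<rho> \<omega> \<gamma> \<delta>"
  shows "instantly_demotes \<rho> \<omega> \<gamma> \<delta>"
proof -
  obtain DA where DA: "0 \<le> DA" "optimal \<delta> \<noteq> 1 \<Longrightarrow> (\<Delta>F \<rho> \<omega> (optimal \<delta> - 1) has_real_derivative DA) (at \<delta> within {0<..pi})"
    using assms(3) by (auto simp: demotion_condition_def \<Delta>F_deriv_nonneg_def Let_def)
  obtain DB where DB: "0 \<le> DB" "(\<Delta>F \<rho> \<omega> (optimal \<delta>) has_real_derivative DB) (at \<delta> within {0<..pi})"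
    using assms(3) by (auto simp: demotion_condition_def \<Delta>F_deriv_nonneg_def Let_def)
  have side: "\<exists>D\<le>0. (Nstar_continuum \<rho> \<omega> \<gamma> has_real_derivative D) (at \<delta> within S)"
    if S: "S \<subseteq> {0<..pi}" "S \<subseteq> {..\<delta>} \<or> S \<subseteq> {\<delta>..}" for S
  proof -
    obtain p q where "0 \<le> p" "0 \<le> q"
      "(Nstar_continuum \<rho> \<omega> \<gamma> has_real_derivative - (p * DA + q * DB)) (at \<delta> within S)"
      using continuum_derivative[OF assms(1,2) DA(2) DB(2) S] by blast
    moreover have "0 \<le> p * DA + q * DB"
      using \<open>0 \<le> p\<close> \<open>0 \<le> q\<close> DA DB by (intro add_nonneg_nonneg mult_nonneg_nonneg)
    ultimately show ?thesis by (metis neg_le_0_iff_le)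
  qed
  show ?thesis
    unfolding instantly_demotes_def by (intro conjI side) (use \<delta> in auto)
qed

section \<open>Monotonicity on intervals\<close>

lemma (in bubble_model) marginal_continuous_on:
  assumes "1 \<le> K" "S \<subseteq> {0<..pi}"
  shows "continuous_on S (marginal K)"
  by (rule continuous_on_subset[OF _ assms(2)]) (auto simp: continuous_on intro: marginal_tendsto assms)

lemma (in bubble_model) marginal_has_derivative_at:
  assumes "(\<Delta>F \<rho> \<omega> K has_real_derivative D) (at x within {0<..pi})" "0 < x" "x < pi"
  shows "(marginal K has_real_derivative 2 * \<gamma> / pi * D) (at x)"
proof -
  have "at x within {0<..pi} = at x"
    by (rule at_within_interior) (use assms in auto)
  then show ?thesis using marginal_has_derivative[OF assms(1)] by simp
qed

text \<open>Wherever the marginal cost is positive near a tie, \<open>K\<close> itself is optimal. At such points the sign condition on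
  the derivative of \<open>\<Delta>F\<close> at the optimal number becomes a statement about \<open>marginal K\<close>.\<close>
lemma (in bubble_model) optimal_near_tie:
  assumes "\<tau> \<in> {0<..pi}" "recip_eigval_decr_convex \<rho> \<tau>" "1 \<le> K" "marginal K \<tau> = 0"
  obtains e where "0 < e"
    "\<And>t. t \<in> {0<..pi} \<Longrightarrow> \<bar>t - \<tau>\<bar> < e \<Longrightarrow> 0 < marginal K t \<Longrightarrow> optimal t = K"
proof -
  have opt: "optimal \<tau> = Suc K" by (rule optimal_of_tie[OF assms])
  obtain e where e: "0 < e" "\<And>t. t \<in> {0<..pi} \<Longrightarrow> t \<noteq> \<tau> \<Longrightarrow> dist t \<tau> < e \<Longrightarrow> minimizer \<tau> (optimal t)"
    using optimal_near_is_minimizer[OF assms(1)] unfolding eventually_at by blast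
  show ?thesis
  proof (rule that[OF e(1)])
    fix t assume t: "t \<in> {0<..pi}" "\<bar>t - \<tau>\<bar> < e" "0 < marginal K t"
    then have "t \<noteq> \<tau>" using assms(4) by auto
    then have "optimal t = Suc K \<or> optimal t = K"
      using minimizer_cases[OF assms(1,2) e(2)[OF t(1)]] t(2) opt by (auto simp: dist_real_def)
    moreover have "optimal t \<noteq> Suc K"
      using marginal_pred_optimal_nonpos[OF t(1) _ assms(3)] t(3) by force
    ultimately show "optimal t = K" by simp
  qed
qed

text \<open>By convexity at \<open>s\<close> it is enough that \<open>marginal K\<close> is still \<open>\<le> 0\<close> at \<open>s\<close>. Otherwise it leaves its last zero
  \<open>\<tau>\<close> upwards, in a region where its derivative is \<open>\<le> 0\<close>.\<close>
lemma (in bubble_model) optimal_mono_on: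
  assumes I: "is_interval I" "I \<subseteq> {0<..pi}"
    and cond: "\<And>\<delta>. \<delta> \<in> I \<Longrightarrow> recip_eigval_decr_convex \<rho> \<delta> \<and> promotion_condition \<rho> \<omega> \<gamma> \<delta>"
  shows "mono_on I optimal"
proof (rule mono_onI)
  fix r s assume rs: "r \<in> I" "s \<in> I" "r \<le> s"
  have sub: "{r..s} \<subseteq> I" using I(1) rs unfolding is_interval_1 by (meson atLeastAtMost_iff subsetI)
  have r: "r \<in> {0<..pi}" and s: "s \<in> {0<..pi}" using rs I by auto
  show "optimal r \<le> optimal s"
  proof (cases "optimal r = 1")
    case True
    then show ?thesis using optimal_ge_1[OF s] by simp
  next
    case False
    then obtain K where K: "optimal r = Suc K" "1 \<le> K"
      using optimal_ge_1[OF r] by (cases "optimal r") auto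
    have "marginal K s \<le> 0"
    proof (rule ccontr)
      assume "\<not> ?thesis"
      then have "0 < marginal K s" by simp
      moreover have "marginal K r \<le> 0" by (rule marginal_pred_optimal_nonpos[OF r K])
      moreover have "continuous_on {r..s} (marginal K)"
        using sub I K(2) by (intro marginal_continuous_on) auto
      ultimately obtain \<tau> where \<tau>: "r \<le> \<tau>" "\<tau> < s" "marginal K \<tau> = 0"
          "\<And>t. \<tau> < t \<Longrightarrow> t \<le> s \<Longrightarrow> 0 < marginal K t"
        using last_zero_before_positive[of r s "marginal K"] rs(3) by blast
      have \<tau>I: "\<tau> \<in> I" "\<tau> \<in> {0<..pi}" using \<tau>(1,2) sub r s by auto
      obtain e where e: "0 < e"
          "\<And>t. t \<in> {0<..pi} \<Longrightarrow> \<bar>t - \<tau>\<bar> < e \<Longrightarrow> 0 < marginal K t \<Longrightarrow> optimal t = K"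
        using optimal_near_tie[OF \<tau>I(2) _ K(2) \<tau>(3)] cond[OF \<tau>I(1)] by blast
      define t where "t = min s (\<tau> + e / 2)"
      have t: "\<tau> < t" "t \<le> s" "t < \<tau> + e" using \<tau> e by (auto simp: t_def min_def)
      have "marginal K t \<le> marginal K \<tau>"
      proof (rule DERIV_nonpos_imp_decreasing_open[where f = "marginal K"])
        show "\<tau> \<le> t" using t by simp
        show "continuous_on {\<tau>..t} (marginal K)"
          using r s K(2) t \<tau>(1,2) by (intro marginal_continuous_on) auto
        fix x assume x: "\<tau> < x" "x < t"
        have xI: "x \<in> I" "x \<in> {0<..pi}" "x < pi" using x t \<tau>(1,2) sub r s by auto
        have "optimal x = K" using x t \<tau> by (intro e(2) xI) auto
        then obtain D where D: "D \<le> 0" "(\<Delta>F \<rho> \<omega> K has_real_derivative D) (at x within {0<..pi})"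
          using cond[OF xI(1)] by (auto simp: promotion_condition_def \<Delta>F_deriv_nonpos_def Let_def)
        have "(marginal K has_real_derivative 2 * \<gamma> / pi * D) (at x)"
          using xI by (intro marginal_has_derivative_at D) auto
        moreover have "2 * \<gamma> / pi * D \<le> 0" using D \<gamma>_pos by (intro mult_nonneg_nonpos) auto
        ultimately show "\<exists>y. (marginal K has_real_derivative y) (at x) \<and> y \<le> 0" by blast
      qed
      then show False using \<tau>(3) \<tau>(4)[OF t(1,2)] by simp
    qed
    then show ?thesis
      using less_optimal_if_marginal_nonpos[OF s _ K(2)] cond[OF rs(2)] K(1) by simp
  qed
qed

text \<open>The same argument run from right to left, at the first zero of \<open>marginal K\<close>.\<close>
lemma (in bubble_model) optimal_antimono_on:
  assumes I: "is_interval I" "I \<subseteq> {0<..pi}"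
    and cond: "\<And>\<delta>. \<delta> \<in> I \<Longrightarrow> recip_eigval_decr_convex \<rho> \<delta> \<and> demotion_condition \<rho> \<omega> \<gamma> \<delta>"
  shows "antimono_on I optimal"
proof (rule monotone_onI)
  fix r s assume rs: "r \<in> I" "s \<in> I" "r \<le> s"
  have sub: "{r..s} \<subseteq> I" using I(1) rs unfolding is_interval_1 by (meson atLeastAtMost_iff subsetI)
  have r: "r \<in> {0<..pi}" and s: "s \<in> {0<..pi}" using rs I by auto
  show "optimal s \<le> optimal r"
  proof (cases "optimal s = 1")
    case True
    then show ?thesis using optimal_ge_1[OF r] by simp
  next
    case False
    then obtain K where K: "optimal s = Suc K" "1 \<le> K"
      using optimal_ge_1[OF s] by (cases "optimal s") auto
    have "marginal K r \<le> 0"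
    proof (rule ccontr)
      assume "\<not> ?thesis"
      then have "0 < marginal K r" by simp
      moreover have "marginal K s \<le> 0" by (rule marginal_pred_optimal_nonpos[OF s K])
      moreover have "continuous_on {r..s} (marginal K)"
        using sub I K(2) by (intro marginal_continuous_on) auto
      ultimately obtain \<tau> where \<tau>: "r < \<tau>" "\<tau> \<le> s" "marginal K \<tau> = 0"
          "\<And>t. r \<le> t \<Longrightarrow> t < \<tau> \<Longrightarrow> 0 < marginal K t"
        using first_zero_after_positive[of r s "marginal K"] rs(3) by blast
      have \<tau>I: "\<tau> \<in> I" "\<tau> \<in> {0<..pi}" using \<tau>(1,2) sub r s by auto
      obtain e where e: "0 < e"
          "\<And>t. t \<in> {0<..pi} \<Longrightarrow> \<bar>t - \<tau>\<bar> < e \<Longrightarrow> 0 < marginal K t \<Longrightarrow> optimal t = K"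
        using optimal_near_tie[OF \<tau>I(2) _ K(2) \<tau>(3)] cond[OF \<tau>I(1)] by blast
      define t where "t = max r (\<tau> - e / 2)"
      have t: "t < \<tau>" "r \<le> t" "\<tau> - e < t" using \<tau> e by (auto simp: t_def max_def)
      have "marginal K t \<le> marginal K \<tau>"
      proof (rule DERIV_nonneg_imp_increasing_open[where f = "marginal K"])
        show "t \<le> \<tau>" using t by simp
        show "continuous_on {t..\<tau>} (marginal K)"
          using r s K(2) t \<tau>(1,2) by (intro marginal_continuous_on) auto
        fix x assume x: "t < x" "x < \<tau>"
        have xI: "x \<in> I" "x \<in> {0<..pi}" "x < pi" using x t \<tau>(1,2) sub r s by auto
        have "optimal x = K" using x t \<tau> by (intro e(2) xI) auto
        then obtain D where D: "0 \<le> D" "(\<Delta>F \<rho> \<omega> K has_real_derivative D) (at x within {0<..pi})"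
          using cond[OF xI(1)] by (auto simp: demotion_condition_def \<Delta>F_deriv_nonneg_def Let_def)
        have "(marginal K has_real_derivative 2 * \<gamma> / pi * D) (at x)"
          using xI by (intro marginal_has_derivative_at D) auto
        moreover have "0 \<le> 2 * \<gamma> / pi * D" using D \<gamma>_pos by (intro mult_nonneg_nonneg) auto
        ultimately show "\<exists>y. (marginal K has_real_derivative y) (at x) \<and> 0 \<le> y" by blast
      qed
      then show False using \<tau>(3) \<tau>(4)[OF t(2,1)] by simp
    qed
    then show ?thesis
      using less_optimal_if_marginal_nonpos[OF r _ K(2)] cond[OF rs(1)] K(1) by simp
  qed
qed

section \<open>Promotion and demotion of bubble splitting\<close>

theorem theorem3p4:
  fixes \<rho> :: "real \<Rightarrow> real" and \<gamma> \<omega> :: real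
  assumes "nonlocal_kernel \<rho>" and "0 < \<gamma>" and "0 < \<omega>" and "\<omega> < 1 / 2"
  shows
    "(\<forall>\<delta>\<in>{0<..pi}.
        recip_eigval_decr_convex \<rho> \<delta> \<and> promotion_condition \<rho> \<omega> \<gamma> \<delta>
          \<longrightarrow> instantly_promotes \<rho> \<omega> \<gamma> \<delta>) \<and>
     (\<forall>I. is_interval I \<and> I \<subseteq> {0<..pi} \<and>
        (\<forall>\<delta>\<in>I. recip_eigval_decr_convex \<rho> \<delta> \<and> promotion_condition \<rho> \<omega> \<gamma> \<delta>)
          \<longrightarrow> mono_on I (Nstar \<rho> \<omega> \<gamma>)) \<and>
     (\<forall>\<delta>\<in>{0<..pi}.
        recip_eigval_decr_convex \<rho> \<delta> \<and> demotion_condition \<rho> \<omega> \<gamma> \<delta>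
          \<longrightarrow> instantly_demotes \<rho> \<omega> \<gamma> \<delta>) \<and>
     (\<forall>I. is_interval I \<and> I \<subseteq> {0<..pi} \<and>
        (\<forall>\<delta>\<in>I. recip_eigval_decr_convex \<rho> \<delta> \<and> demotion_condition \<rho> \<omega> \<gamma> \<delta>)
          \<longrightarrow> antimono_on I (Nstar \<rho> \<omega> \<gamma>))"
proof -
  interpret bubble_model \<rho> \<gamma> \<omega> by unfold_locales (rule assms)+
  show ?thesis
    by (intro conjI ballI allI impI; elim conjE)
      (rule promotes demotes optimal_mono_on optimal_antimono_on; blast)+
qed

end
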